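(* Let $\mathbf{tr}$ be the Tribonacci word, the fixed point of the morphism $0\mapsto01$, $1\mapsto02$, $2\mapsto0$ starting with $0$. The additive complexity $\rho^{\mathrm{add}}_{\mathbf{tr}}(n)$ takes only values in $\{3,4,5\}$ for $n\ge1$. Furthermore, each of the three values $3,4,5$ is taken for infinitely many $n$, and $\rho^{\mathrm{add}}_{\mathbf{tr}}$ is computed by a $76$-state Tribonacci DFAO.
   Context: Letters $0,1,2$ are regarded as integers. Words $u,v$ are additively equivalent if $|u|=|v|$ and $|u|_1+2|u|_2=|v|_1+2|v|_2$ ($|w|_a$ counts occurrences of $a$); $\rho^{\mathrm{add}}_{\mathbf{tr}}(n)$ is the number of additive equivalence classes of length-$n$ factors of $\mathbf{tr}$. Tribonacci numbers: $T(0)=1,T(1)=2,T(2)=4$, $T(n)=T(n-1)+T(n-2)+T(n-3)$ for $n\ge3$. The Tribonacci representation of $n$ is its greedy representation $n=\sum_{i=0}^t c(i)T(i)$ written most significant digit first (empty for $n=0$). A Tribonacci DFAO is a deterministic finite automaton with output which, on input the Tribonacci representation of $n$, outputs the $n$th term. *)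

theory Defs
  imports Main "HOL-Library.Stream"
begin

section \<open>Morphisms and the Tribonacci word\<close>

text \<open>
  Finite words are lists, infinite words are streams, letters are natural numbers.
  The image of an infinite word under a morphism is the infinite concatenation of the images of
  its letters.  As \<^const>\<open>flat\<close> is only meaningful for streams of nonempty lists, this is
  the extension of \<open>h\<close> to infinite words only for nonerasing \<open>h\<close>.
\<close>

definition morph_image :: "('a \<Rightarrow> 'b list) \<Rightarrow> 'a stream \<Rightarrow> 'b stream" where
  "morph_image h w = flat (smap h w)"

text \<open>Only the letters 0, 1, 2 matter; every other natural number is treated like the letter 2.\<close>

definition trib_morph :: "nat \<Rightarrow> nat list" where
  "trib_morph a = (if a = 0 then [0, 1] else if a = 1 then [0, 2] else [0])"

definition tr :: "nat stream" where
  "tr = (THE w. morph_image trib_morph w = w \<and> shd w = 0)"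

text \<open>The description of \<open>tr\<close> is proper: see \<open>ex1_tr\<close> and \<open>sset_tr\<close> below.\<close>

abbreviation trib_morph_list :: "nat list \<Rightarrow> nat list" where
  "trib_morph_list u \<equiv> concat (map trib_morph u)"

lemma trib_morph_nonempty [simp]: "trib_morph a \<noteq> []"
  by (simp add: trib_morph_def)

lemma morph_image_shift:
  "morph_image trib_morph (u @- w) = trib_morph_list u @- morph_image trib_morph w"
  by (induction u) (simp_all add: morph_image_def)

lemma trib_morph_iter_append:
  "(trib_morph_list ^^ k) (u @ v) = (trib_morph_list ^^ k) u @ (trib_morph_list ^^ k) v"
  by (induction k) simp_all

lemma trib_morph_iter_nonempty: "u \<noteq> [] \<Longrightarrow> (trib_morph_list ^^ k) u \<noteq> []"
proof (induction k)
  case (Suc k)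
  then obtain a v where "(trib_morph_list ^^ k) u = a # v"
    by (cases "(trib_morph_list ^^ k) u") auto
  then show ?case by simp
qed simp

lemma trib_morph_iter_Suc:
  "(trib_morph_list ^^ Suc k) [0] = (trib_morph_list ^^ k) [0] @ (trib_morph_list ^^ k) [1]"
proof -
  have "(trib_morph_list ^^ Suc k) [0] = (trib_morph_list ^^ k) ([0] @ [1])"
    by (simp add: funpow_Suc_right trib_morph_def del: funpow.simps)
  then show ?thesis by (simp only: trib_morph_iter_append)
qed

lemma length_trib_morph_iter: "k < length ((trib_morph_list ^^ k) [0])"
proof (induction k)
  case (Suc k)
  have "(trib_morph_list ^^ k) [1] \<noteq> []" by (rule trib_morph_iter_nonempty) simp
  then have "0 < length ((trib_morph_list ^^ k) [1])" by blast
  with Suc show ?case unfolding trib_morph_iter_Suc length_append by linarith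
qed simp

lemma trib_morph_iter_prefix:
  "k \<le> l \<Longrightarrow> \<exists>v. (trib_morph_list ^^ l) [0] = (trib_morph_list ^^ k) [0] @ v"
proof (induction rule: dec_induct)
  case (step l)
  then show ?case unfolding trib_morph_iter_Suc by auto
qed simp

lemma trib_morph_iter_nth:
  assumes "n < length ((trib_morph_list ^^ k) [0])"
  shows "(trib_morph_list ^^ n) [0] ! n = (trib_morph_list ^^ k) [0] ! n"
proof (cases "k \<le> n")
  case True
  then show ?thesis using trib_morph_iter_prefix[of k n] assms by (auto simp: nth_append)
next
  case False
  then show ?thesis using trib_morph_iter_prefix[of n k] length_trib_morph_iter[of n]
    by (auto simp: nth_append)
qed

lemma trib_fixed_point_prefix:
  assumes "morph_image trib_morph w = w" "shd w = 0"
  shows "\<exists>v. w = (trib_morph_list ^^ k) [0] @- v"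
proof (induction k)
  case 0
  show ?case using assms(2) by (intro exI[of _ "stl w"]) (metis funpow_0 shift.simps stream.collapse)
next
  case (Suc k)
  then obtain v where v: "w = (trib_morph_list ^^ k) [0] @- v" by blast
  have "w = (trib_morph_list ^^ Suc k) [0] @- morph_image trib_morph v"
    using morph_image_shift[of "(trib_morph_list ^^ k) [0]" v] assms(1) v by simp
  then show ?case by blast
qed

lemma snth_trib_fixed_point:
  assumes "morph_image trib_morph w = w" "shd w = 0"
  shows "w !! n = (trib_morph_list ^^ n) [0] ! n"
  using trib_fixed_point_prefix[OF assms, of n] length_trib_morph_iter[of n] by auto

lemma ex1_tr: "\<exists>!w. morph_image trib_morph w = w \<and> shd w = 0"
proof (rule ex_ex1I)
  define w where "w = smap (\<lambda>n. (trib_morph_list ^^ n) [0] ! n) nats"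
  have nth: "w !! n = (trib_morph_list ^^ n) [0] ! n" for n by (simp add: w_def)
  have prefix: "stake (length ((trib_morph_list ^^ k) [0])) w = (trib_morph_list ^^ k) [0]" for k
    by (rule nth_equalityI) (simp_all add: nth trib_morph_iter_nth)
  have "morph_image trib_morph w !! n = w !! n" for n
  proof -
    define u where "u = (trib_morph_list ^^ n) [0]"
    have "w = u @- sdrop (length u) w"
      using stake_sdrop[of "length u" w] prefix[of n] by (simp add: u_def)
    then have "morph_image trib_morph w
        = (trib_morph_list ^^ Suc n) [0] @- morph_image trib_morph (sdrop (length u) w)"
      using morph_image_shift[of u "sdrop (length u) w"] by (simp add: u_def)
    moreover have "n < length ((trib_morph_list ^^ Suc n) [0])"
      using length_trib_morph_iter[of "Suc n"] by linarith
    ultimately have "morph_image trib_morph w !! n = (trib_morph_list ^^ Suc n) [0] ! n"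
      by (metis shift_snth_less)
    also have "\<dots> = w !! n"
      using \<open>n < length ((trib_morph_list ^^ Suc n) [0])\<close> by (metis nth trib_morph_iter_nth)
    finally show ?thesis .
  qed
  then have "morph_image trib_morph w = w" by (metis ext snth.simps smap_alt stream.map_id)
  moreover have "shd w = 0" using nth[of 0] by simp
  ultimately show "\<exists>w. morph_image trib_morph w = w \<and> shd w = 0" by blast
next
  fix v w
  assume "morph_image trib_morph v = v \<and> shd v = 0" "morph_image trib_morph w = w \<and> shd w = 0"
  then have "v !! n = w !! n" for n using snth_trib_fixed_point by simp
  then show "v = w" by (metis smap_alt stream.map_id)
qed

lemma morph_image_tr: "morph_image trib_morph tr = tr" and shd_tr: "shd tr = 0"
  using theI'[OF ex1_tr] by (simp_all add: tr_def)

lemma sset_tr: "sset tr \<subseteq> {0, 1, 2}"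
proof -
  have "sset (morph_image trib_morph tr) = (\<Union>a \<in> sset tr. set (trib_morph a))"
    unfolding morph_image_def by (subst sset_flat) (auto simp: stream.set_map)
  also have "\<dots> \<subseteq> {0, 1, 2}" by (auto simp: trib_morph_def split: if_splits)
  finally show ?thesis unfolding morph_image_tr .
qed

section \<open>Additive complexity\<close>

definition factors :: "'a stream \<Rightarrow> nat \<Rightarrow> 'a list set" where
  "factors w n = {stake n (sdrop i w) | i. True}"

definition add_equiv :: "nat list \<Rightarrow> nat list \<Rightarrow> bool" where
  "add_equiv u v \<longleftrightarrow> length u = length v \<and>
     count_list u 1 + 2 * count_list u 2 = count_list v 1 + 2 * count_list v 2"

definition add_complexity :: "nat stream \<Rightarrow> nat \<Rightarrow> nat" where
  "add_complexity w n =
     card (factors w n // {(u, v). u \<in> factors w n \<and> v \<in> factors w n \<and> add_equiv u v})"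

lemma equiv_add_equiv: "equiv A {(u, v). u \<in> A \<and> v \<in> A \<and> add_equiv u v}"
  by (rule equivI) (auto simp: refl_on_def sym_def trans_def add_equiv_def)

section \<open>Tribonacci representations\<close>

fun trib :: "nat \<Rightarrow> nat" where
  "trib 0 = 1"
| "trib (Suc 0) = 2"
| "trib (Suc (Suc 0)) = 4"
| "trib (Suc (Suc (Suc n))) = trib (Suc (Suc n)) + trib (Suc n) + trib n"

text \<open>\<open>greedy_digits k n\<close> lists the digits for \<open>trib (k - 1), \<dots>, trib 0\<close>, in this order.\<close>

primrec greedy_digits :: "nat \<Rightarrow> nat \<Rightarrow> nat list" where
  "greedy_digits 0 n = []"
| "greedy_digits (Suc k) n = (n div trib k) # greedy_digits k (n mod trib k)"

text \<open>The length is the least possible one, so there are no leading zeros and \<open>trib_rep 0 = []\<close>.\<close>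

definition trib_rep :: "nat \<Rightarrow> nat list" where
  "trib_rep n = greedy_digits (LEAST k. n < trib k) n"

lemma trib_pos: "0 < trib n"
  by (induction n rule: trib.induct) simp_all

lemma trib_less_Suc: "trib n < trib (Suc n)"
  by (induction n rule: trib.induct) (simp_all add: trib_pos)

lemma trib_Suc_le: "trib (Suc n) \<le> 2 * trib n"
proof (induction n rule: trib.induct)
  case (4 n)
  then show ?case using trib_pos[of n] by simp
qed simp_all

lemma trib_gt: "n < trib n"
proof (induction n)
  case (Suc n)
  then show ?case using trib_less_Suc[of n] by linarith
qed simp

lemma trib_rep_length: "n < trib (length (trib_rep n))"
proof -
  have "length (greedy_digits k m) = k" for k m by (induction k arbitrary: m) simp_all
  then show ?thesis unfolding trib_rep_def using LeastI[of "\<lambda>k. n < trib k", OF trib_gt] by simp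
qed

lemma set_trib_rep: "set (trib_rep n) \<subseteq> {0, 1}"
proof -
  have "set (greedy_digits k m) \<subseteq> {0, 1}" if "m < trib k" for k m
    using that
  proof (induction k arbitrary: m)
    case (Suc k)
    have "m div trib k < 2"
      using Suc.prems trib_Suc_le[of k] by (simp add: less_mult_imp_div_less)
    moreover have "set (greedy_digits k (m mod trib k)) \<subseteq> {0, 1}"
      by (rule Suc.IH) (simp add: trib_pos)
    ultimately show ?case by auto
  qed simp
  then show ?thesis unfolding trib_rep_def using LeastI[of "\<lambda>k. n < trib k", OF trib_gt] by simp
qed

lemma trib_rep_value: "(\<Sum>i<length (trib_rep n). rev (trib_rep n) ! i * trib i) = n"
proof -
  have len: "length (greedy_digits k m) = k" for k m by (induction k arbitrary: m) simp_all
  have "(\<Sum>i<k. rev (greedy_digits k m) ! i * trib i) = m" if "m < trib k" for k m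
    using that
  proof (induction k arbitrary: m)
    case (Suc k)
    have "(\<Sum>i<k. rev (greedy_digits k (m mod trib k)) ! i * trib i) = m mod trib k"
      by (rule Suc.IH) (simp add: trib_pos)
    then show ?case by (simp add: nth_append len)
  qed simp
  then show ?thesis
    unfolding trib_rep_def len using LeastI[of "\<lambda>k. n < trib k", OF trib_gt] by simp
qed

section \<open>Automata with output\<close>

record ('q, 'a, 'o) dfao =
  states :: "'q set"
  initial :: 'q
  trans :: "'q \<Rightarrow> 'a \<Rightarrow> 'q"
  outp :: "'q \<Rightarrow> 'o"

definition is_dfao :: "'a set \<Rightarrow> ('q, 'a, 'o) dfao \<Rightarrow> bool" where
  "is_dfao \<Sigma> M \<longleftrightarrow> finite (states M) \<and> initial M \<in> states M \<and>
     (\<forall>q\<in>states M. \<forall>a\<in>\<Sigma>. trans M q a \<in> states M)"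

definition dfao_output :: "('q, 'a, 'o) dfao \<Rightarrow> 'a list \<Rightarrow> 'o" where
  "dfao_output M u = outp M (foldl (trans M) (initial M) u)"

text \<open>
  As every greedy representation is a word over \<open>{0, 1}\<close> (\<open>set_trib_rep\<close>), this is the input
  alphabet.  There is no condition on inputs that are not the representation of a number.
\<close>

definition trib_dfao_computes :: "('q, nat, 'o) dfao \<Rightarrow> (nat \<Rightarrow> 'o) \<Rightarrow> bool" where
  "trib_dfao_computes M f \<longleftrightarrow> is_dfao {0, 1} M \<and> (\<forall>n. dfao_output M (trib_rep n) = f n)"

end

theory Submission
  imports Defs "HOL-Library.Product_Plus"
begin

text \<open>
  Every position of the Tribonacci word is read digit by digit along its Tribonacci representation,
  and appending a digit \<open>d\<close> to the representation of \<open>i\<close> turns the Parikh vector \<open>v\<close> of the prefix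
  of length \<open>i\<close> into \<open>M v + (d, 0, 0)\<close>, where \<open>M\<close> is the incidence matrix of the morphism.  Reading
  positions \<open>i\<close>, \<open>j\<close> and the number \<open>n\<close> in parallel, the vector \<open>r\<close> = Parikh vector of the prefix of
  length \<open>j\<close> minus those of the prefixes of lengths \<open>i\<close> and \<open>n\<close> is thus updated by \<open>M\<close> and the digit
  difference.  Its coordinate sum is \<open>j - i - n\<close>, so the factors of length \<open>n\<close> correspond to the final
  vectors of coordinate sum 0.  The two contracting eigenvalues of \<open>M\<close> keep \<open>r\<close> near the dominant
  eigenline, and once it is far out on that line it can never return to coordinate sum 0; hence only
  finitely many \<open>r\<close> matter.  The set of vectors attained for all \<open>i\<close>, \<open>j\<close> is therefore a state of a
  finite subset automaton driven by the digits of \<open>n\<close>, and that automaton is compared with an explicit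
  automaton with 76 states.
\<close>

section \<open>Positions and Parikh vectors\<close>

type_synonym vec = "int \<times> int \<times> int"
type_synonym state = "nat \<times> nat \<times> vec"

text \<open>
  The letter at a position is the number of trailing ones of its representation; \<open>children a\<close> lists
  the admissible next digits together with the next letter.
\<close>

definition children :: "nat \<Rightarrow> (int \<times> nat) list" where
  "children a = (0, 0) # (if a = 0 then [(1, 1)] else if a = 1 then [(1, 2)] else [])"

text \<open>Multiplication by \<open>M\<close>: every letter image contains one 0, the image of 0
  adds a 1 and that of 1 a 2. A digit 1 steps past the leading 0 of an image, so digits act on the
  first coordinate.\<close>

fun advance :: "int \<Rightarrow> vec \<Rightarrow> vec" where
  "advance k (x, y, z) = (x + y + z + k, x, y)"

text \<open>
  In a state \<open>(a, b, r)\<close>, \<open>a\<close> and \<open>b\<close> are the letters at the positions \<open>i\<close> and \<open>j\<close> read so far; \<open>c\<close> is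
  the next digit of \<open>n\<close>.
\<close>

fun succs :: "int \<Rightarrow> state \<Rightarrow> state list" where
  "succs c (a, b, r) =
     [(a', b', advance (e - d - c) r). (d, a') \<leftarrow> children a, (e, b') \<leftarrow> children b]"

fun weight :: "vec \<Rightarrow> int" where
  "weight (x, y, z) = x + y + z"

definition unit_vec :: "nat \<Rightarrow> vec" where
  "unit_vec a = (if a = 0 then (1, 0, 0) else if a = 1 then (0, 1, 0) else (0, 0, 1))"

definition parikh :: "nat list \<Rightarrow> vec" where
  "parikh u = sum_list (map unit_vec u)"

lemma parikh_simps [simp]:
  "parikh [] = 0" "parikh (a # u) = unit_vec a + parikh u" "parikh (u @ v) = parikh u + parikh v"
  by (simp_all add: parikh_def)

lemma advance_0_add: "advance 0 (u + v) = advance 0 u + advance 0 v"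
  by (cases u; cases v) simp

lemma advance_eq_add: "advance k r = advance 0 r + (k, 0, 0)"
  by (cases r) simp

definition power_M :: "nat \<Rightarrow> vec \<Rightarrow> vec" where
  "power_M k = (advance 0 ^^ k)"

lemma power_M_0 [simp]: "power_M 0 v = v"
  by (simp add: power_M_def)

lemma power_M_Suc: "power_M (Suc k) v = power_M k (advance 0 v)"
  by (simp add: power_M_def funpow_swap1)

lemma power_M_add: "power_M k (u + v) = power_M k u + power_M k v"
  by (induction k arbitrary: u v) (simp_all add: power_M_Suc advance_0_add)

lemma power_M_zero [simp]: "power_M k 0 = 0"
  using power_M_add[of k 0 0] by simp

lemma power_M_diff: "power_M k (u - v) = power_M k u - power_M k v"
  using power_M_add[of k "u - v" v] by simp

lemma parikh_trib_morph_list: "parikh (trib_morph_list u) = advance 0 (parikh u)"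
proof (induction u)
  case (Cons a u)
  have "parikh (trib_morph a) = advance 0 (unit_vec a)"
    by (simp add: trib_morph_def unit_vec_def)
  with Cons show ?case by (simp add: advance_0_add)
qed (simp add: zero_prod_def)

section \<open>Iterated images of letters and the positions in them\<close>

definition block :: "nat \<Rightarrow> nat \<Rightarrow> nat list" where
  "block k a = (trib_morph_list ^^ k) [a]"

lemma block_0 [simp]: "block 0 a = [a]"
  by (simp add: block_def)

lemma block_Suc:
  "block (Suc k) a = block k 0 @ (if a = 0 then block k 1 else if a = 1 then block k 2 else [])"
proof -
  have nil: "(trib_morph_list ^^ k) [] = []" by (induction k) simp_all
  have "block (Suc k) a = (trib_morph_list ^^ k) (trib_morph a)"
    by (simp add: block_def funpow_Suc_right del: funpow.simps)
  also have "trib_morph a = [0] @ (if a = 0 then [1] else if a = 1 then [2] else [])"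
    by (simp add: trib_morph_def)
  finally show ?thesis by (simp add: trib_morph_iter_append block_def nil del: append.simps)
qed

lemma length_block_0: "length (block k 0) = trib k"
  by (induction k rule: trib.induct) (simp_all add: block_Suc)

lemma length_block_le: "length (block k a) \<le> trib k"
proof -
  have "length (block k 2) \<le> length (block k 1) \<and> length (block k 1) \<le> length (block k 0)"
    by (induction k) (simp_all add: block_Suc)
  \<comment> \<open>Letters above 2 share the image of 2, so from level 1 on their blocks agree; at
    level 0 all lengths are 1.\<close>
  moreover have "a = 0 \<or> a = 1 \<or> length (block k a) = length (block k 2)"
    by (cases k) (simp_all add: block_Suc)
  ultimately show ?thesis unfolding length_block_0[symmetric] by (elim disjE) simp_all
qed

lemma parikh_block_0: "parikh (block k 0) = power_M k (1, 0, 0)"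
proof -
  have "parikh ((trib_morph_list ^^ k) u) = power_M k (parikh u)" for u
    by (induction k) (simp_all add: power_M_def parikh_trib_morph_list)
  from this[of "[0]"] show ?thesis by (simp add: block_def unit_vec_def)
qed

text \<open>\<open>block (Suc k) a\<close> is \<open>block k 0\<close>, followed for
  \<open>a \<le> 1\<close> by \<open>block k (a + 1)\<close>. Digit 0 stays in the first part; digit
  1 skips it, passing \<open>trib k\<close> letters with Parikh vector
  \<open>power_M k (1, 0, 0)\<close>.\<close>

lemma child_position:
  assumes "(d, a') \<in> set (children a)" "i < length (block k a')"
  shows "nat d * trib k + i < length (block (Suc k) a)"
    and "block (Suc k) a ! (nat d * trib k + i) = block k a' ! i"
    and "parikh (take (nat d * trib k + i) (block (Suc k) a))
           = power_M k (d, 0, 0) + parikh (take i (block k a'))"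
proof -
  have "power_M k (0, 0, 0) = 0" using power_M_zero by (simp add: zero_prod_def)
  then show "nat d * trib k + i < length (block (Suc k) a)"
    and "block (Suc k) a ! (nat d * trib k + i) = block k a' ! i"
    and "parikh (take (nat d * trib k + i) (block (Suc k) a))
           = power_M k (d, 0, 0) + parikh (take i (block k a'))"
    using assms
    by (auto simp: children_def block_Suc nth_append length_block_0 parikh_block_0 split: if_splits)
qed

lemma position_child:
  assumes "i < length (block (Suc k) a)"
  shows "\<exists>d a'. (d, a') \<in> set (children a) \<and> d = int (i div trib k) \<and>
    i mod trib k < length (block k a')"
proof (cases "i < trib k")
  case True
  then show ?thesis by (intro exI[of _ 0] exI[of _ "0::nat"]) (simp add: children_def length_block_0)
next
  case False
  define a' where "a' = Suc a"
  have a': "(1, a') \<in> set (children a)" "i - trib k < length (block k a')"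
    using assms False
    by (auto simp: block_Suc length_block_0 children_def a'_def numeral_2_eq_2 split: if_splits)
  \<comment> \<open>The second part is no longer than \<open>trib k\<close>, so the greedy quotient
    is exactly 1.\<close>
  then have "i - trib k < trib k" using length_block_le[of k a'] by linarith
  then have "i div trib k = 1" "i mod trib k = i - trib k"
    using False by (simp_all add: le_div_geq le_mod_geq)
  then show ?thesis using a' by (intro exI[of _ 1] exI[of _ a']) simp
qed

definition points :: "nat \<Rightarrow> nat \<Rightarrow> (nat \<times> vec) set" where
  "points k a = (\<lambda>i. (block k a ! i, parikh (take i (block k a)))) ` {..<length (block k a)}"

lemma points_0: "points 0 a = {(a, 0)}"
  by (auto simp: points_def)

lemma points_Suc:
  "points (Suc k) a =
     (\<Union>(d, a') \<in> set (children a). (\<lambda>(l, v). (l, power_M k (d, 0, 0) + v)) ` points k a')"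
  (is "?L = ?R")
proof
  show "?R \<subseteq> ?L"
  proof
    fix p assume "p \<in> ?R"
    then obtain d a' i where da: "(d, a') \<in> set (children a)" "i < length (block k a')"
      "p = (block k a' ! i, power_M k (d, 0, 0) + parikh (take i (block k a')))"
      by (auto simp: points_def)
    then show "p \<in> ?L"
      using child_position[OF da(1,2)] unfolding points_def
      by (intro image_eqI[of _ _ "nat d * trib k + i"]) simp_all
  qed
  show "?L \<subseteq> ?R"
  proof
    fix p assume "p \<in> ?L"
    then obtain i where i: "i < length (block (Suc k) a)"
      "p = (block (Suc k) a ! i, parikh (take i (block (Suc k) a)))"
      by (auto simp: points_def)
    obtain d a' where da: "(d, a') \<in> set (children a)" "d = int (i div trib k)"
      "i mod trib k < length (block k a')"
      using position_child[OF i(1)] by blast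
    have "nat d * trib k + i mod trib k = i" using da(2) by simp
    then have "p = (block k a' ! (i mod trib k),
        power_M k (d, 0, 0) + parikh (take (i mod trib k) (block k a')))"
      using child_position(2,3)[OF da(1,3)] i(2) by simp
    then show "p \<in> ?R" using da by (force simp: points_def)
  qed
qed

section \<open>Digit words without three consecutive ones, and the parallel run\<close>

fun valid :: "nat \<Rightarrow> nat list \<Rightarrow> bool" where
  "valid t [] \<longleftrightarrow> True"
| "valid t (c # w) \<longleftrightarrow> (\<exists>t'. (int c, t') \<in> set (children t) \<and> valid t' w)"

lemma valid_greedy_digits: "m < length (block k t) \<Longrightarrow> valid t (greedy_digits k m)"
proof (induction k arbitrary: m t)
  case (Suc k)
  then show ?case using position_child[OF Suc.prems] by auto
qed simp

text \<open>Serves the pumping argument, which prescribes digit words and needs numbers that have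
  them.\<close>

lemma greedy_digits_valid:
  "valid t w \<Longrightarrow> \<exists>m < length (block (length w) t). greedy_digits (length w) m = w"
proof (induction w arbitrary: t)
  case (Cons c w)
  then obtain t' where "(int c, t') \<in> set (children t)" "valid t' w" by auto
  with Cons.IH obtain m where t': "(int c, t') \<in> set (children t)"
    "m < length (block (length w) t')" "greedy_digits (length w) m = w"
    by blast
  moreover have "m < trib (length w)" using t'(2) length_block_le order_less_le_trans by blast
  ultimately show ?case
    using child_position(1)[OF t'(1,2)]
    by (intro exI[of _ "nat (int c) * trib (length w) + m"]) simp
qed simp

fun run :: "nat list \<Rightarrow> state set \<Rightarrow> state set" where
  "run [] Q = Q"
| "run (c # w) Q = run w (\<Union>q\<in>Q. set (succs (int c) q))"

lemma run_UN: "run w (\<Union>q\<in>Q. f q) = (\<Union>q\<in>Q. run w (f q))"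
  by (induction w arbitrary: f) (simp_all only: run.simps UN_UN_flatten)

text \<open>By linearity \<open>r\<close> is carried through \<open>k\<close> digits to
  \<open>power_M k r\<close>, while the digits of the positions below \<open>b\<close>, below
  \<open>a\<close> and of \<open>m\<close> build up their prefix Parikh vectors with signs +, -, -.
  Arbitrary letters and \<open>r\<close> let the induction on \<open>k\<close> go through.\<close>

lemma run_greedy_digits:
  assumes "m < length (block k t)"
  shows "run (greedy_digits k m) {(a, b, r)} =
    {(l, l', power_M k r + v' - v - parikh (take m (block k t))) |l v l' v'.
      (l, v) \<in> points k a \<and> (l', v') \<in> points k b}"
  using assms
proof (induction k arbitrary: m t a b r)
  case 0
  have "{(l, l', r + v' - v - 0) |l v l' v'. (l, v) \<in> points 0 a \<and> (l', v') \<in> points 0 b}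
      = {(a, b, r + 0 - 0 - 0)}"
    unfolding points_0 by blast
  moreover have "m = 0" using 0 by simp
  ultimately show ?case by (simp only: greedy_digits.simps run.simps power_M_0 take_0 parikh_simps
        diff_0_right add_0_right)
next
  case (Suc k)
  obtain c t' where c: "(c, t') \<in> set (children t)" "c = int (m div trib k)"
    "m mod trib k < length (block k t')"
    using position_child[OF Suc.prems] by blast
  have m: "parikh (take m (block (Suc k) t))
      = power_M k (c, 0, 0) + parikh (take (m mod trib k) (block k t'))"
    using child_position(3)[OF c(1,3)] c(2) by simp
  have pow: "power_M k (advance (e - d - c) r)
      = power_M (Suc k) r + power_M k (e, 0, 0) - power_M k (d, 0, 0) - power_M k (c, 0, 0)" for d e
  proof -
    have "advance (e - d - c) r = advance 0 r + (e, 0, 0) - (d, 0, 0) - (c, 0, 0)"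
      by (simp add: advance_eq_add[of "e - d - c"])
    then show ?thesis by (simp add: power_M_Suc power_M_add power_M_diff)
  qed
  have point: "(l, u) \<in> points (Suc k) a \<longleftrightarrow> (\<exists>d a' v. (d, a') \<in> set (children a) \<and>
      (l, v) \<in> points k a' \<and> u = power_M k (d, 0, 0) + v)" for l u a
    unfolding points_Suc by force
  define w where "w = greedy_digits k (m mod trib k)"
  have "run (greedy_digits (Suc k) m) {(a, b, r)} = (\<Union>q \<in> set (succs c (a, b, r)). run w {q})"
    using run_UN[of w "\<lambda>q. {q}" "set (succs c (a, b, r))"] c(2) by (simp add: w_def del: succs.simps)
  also have "\<dots> = {(l, l', power_M (Suc k) r + v' - v - parikh (take m (block (Suc k) t))) |l v l' v'.
      (l, v) \<in> points (Suc k) a \<and> (l', v') \<in> points (Suc k) b}" (is "?A = ?B")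
  proof
    show "?A \<subseteq> ?B"
    proof
      fix p assume "p \<in> ?A"
      then obtain d a' e b' where de: "(d, a') \<in> set (children a)" "(e, b') \<in> set (children b)"
        and p: "p \<in> run w {(a', b', advance (e - d - c) r)}"
        by auto
      from p obtain l v l' v' where "(l, v) \<in> points k a'" "(l', v') \<in> points k b'"
        and p: "p = (l, l', power_M k (advance (e - d - c) r) + v' - v
          - parikh (take (m mod trib k) (block k t')))"
        unfolding w_def Suc.IH[OF c(3)] by blast
      then have "(l, power_M k (d, 0, 0) + v) \<in> points (Suc k) a"
        "(l', power_M k (e, 0, 0) + v') \<in> points (Suc k) b"
        using de unfolding point by blast+
      moreover have "p = (l, l', power_M (Suc k) r + (power_M k (e, 0, 0) + v')
          - (power_M k (d, 0, 0) + v) - parikh (take m (block (Suc k) t)))"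
        unfolding p pow m by (simp add: algebra_simps)
      ultimately show "p \<in> ?B" by blast
    qed
    show "?B \<subseteq> ?A"
    proof
      fix p assume "p \<in> ?B"
      then obtain l u l' u' where lu: "(l, u) \<in> points (Suc k) a" "(l', u') \<in> points (Suc k) b"
        and p: "p = (l, l', power_M (Suc k) r + u' - u - parikh (take m (block (Suc k) t)))"
        by blast
      obtain d a' v where d: "(d, a') \<in> set (children a)" "(l, v) \<in> points k a'"
        "u = power_M k (d, 0, 0) + v"
        using lu(1) unfolding point by blast
      obtain e b' v' where e: "(e, b') \<in> set (children b)" "(l', v') \<in> points k b'"
        "u' = power_M k (e, 0, 0) + v'"
        using lu(2) unfolding point by blast
      have "p = (l, l', power_M k (advance (e - d - c) r) + v' - v
          - parikh (take (m mod trib k) (block k t')))"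
        unfolding p pow m d(3) e(3) by (simp add: algebra_simps)
      then have "p \<in> run w {(a', b', advance (e - d - c) r)}"
        using d(2) e(2) unfolding w_def Suc.IH[OF c(3)] by blast
      moreover have "(a', b', advance (e - d - c) r) \<in> set (succs c (a, b, r))"
        using d(1) e(1) by force
      ultimately show "p \<in> ?A" by blast
    qed
  qed
  finally show ?case .
qed

section \<open>Finitely many relevant states\<close>

text \<open>
  Two absorbing regions that contain no vector of coordinate sum 0, one on each side of the dominant
  eigenline.
\<close>

fun escaping :: "vec \<Rightarrow> bool" where
  "escaping (x, y, z) \<longleftrightarrow> 1 \<le> x \<and> 1 \<le> y \<and> 1 \<le> z \<or>
     x \<le> 0 \<and> y \<le> 0 \<and> z \<le> 0 \<and> x + y \<le> -1 \<and> x + z \<le> -1 \<and> y + z \<le> -1"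

text \<open>
  A row \<open>(r, ps, hs)\<close> stands for the states \<open>(a, b, r)\<close> with \<open>(a, b)\<close> in \<open>ps\<close>: these are the states
  outside the escaping regions that can be reached from \<open>(0, 0, 0)\<close>.  The states with \<open>(a, b)\<close> in \<open>hs\<close>
  are those from which coordinate sum 0 can still be reached.  Both lists were found by search; only
  the closure properties checked by \<open>row_ok\<close> are needed.
\<close>

definition reach_table :: "(vec \<times> (nat \<times> nat) list \<times> (nat \<times> nat) list) list" where
  "reach_table = [
   ((-5,-3,1), [(2,0)], []),
   ((-4,-3,1), [(0,0), (2,0), (2,1)], []),
   ((-4,-2,1), [(1,0), (2,0)], []),
   ((-4,0,0), [(1,0)], []),
   ((-3,-3,1), [(0,0), (0,1), (2,1)], []),
   ((-3,-2,1), [(0,0), (1,0), (1,1), (2,0), (2,1)], []),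
   ((-3,-1,1), [(1,0), (2,0)], []),
   ((-3,0,0), [(0,0), (1,0), (2,0)], []),
   ((-3,1,-1), [(1,0)], []),
   ((-2,-3,1), [(0,1)], []),
   ((-2,-2,1), [(0,0), (0,1), (1,1), (2,0), (2,1)], []),
   ((-2,-1,1), [(0,0), (1,0), (1,1), (2,0), (2,1), (2,2)], []),
   ((-2,-1,2), [(2,0)], []),
   ((-2,0,0), [(0,0), (1,0), (1,1), (1,2), (2,0), (2,1), (2,2)], []),
   ((-2,0,1), [(1,0), (2,0)], []),
   ((-2,1,-1), [(0,0), (1,0), (1,2)], []),
   ((-2,1,0), [(1,0), (2,0)], []),
   ((-1,-2,1), [(0,0), (0,1), (2,1)], []),
   ((-1,-1,1), [(0,0), (0,1), (0,2), (1,0), (1,1), (2,0), (2,1), (2,2)], []),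
   ((-1,-1,2), [(0,0), (2,0), (2,1)], [(0,0), (2,0), (2,1)]),
   ((-1,0,0), [(0,0), (0,1), (0,2), (1,0), (1,1), (1,2), (2,0), (2,1), (2,2)], []),
   ((-1,0,1), [(0,0), (1,0), (1,1), (1,2), (2,0), (2,1), (2,2)], [(0,0), (1,0), (1,1), (1,2),
       (2,0), (2,1), (2,2)]),
   ((-1,0,2), [(1,0), (2,0)], [(1,0), (2,0)]),
   ((-1,1,-1), [(0,0), (0,2), (1,0), (1,1), (1,2)], [(0,0), (1,0), (1,1)]),
   ((-1,1,0), [(0,0), (1,0), (1,1), (1,2), (2,0), (2,2)], [(0,0), (1,0), (1,1), (1,2), (2,0),
       (2,2)]),
   ((-1,1,1), [(1,0), (2,0)], [(1,0), (2,0)]),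
   ((-1,2,-1), [(1,0)], [(1,0)]),
   ((-1,2,0), [(1,0)], [(1,0)]),
   ((0,-2,0), [(0,1)], []),
   ((0,-2,1), [(0,1)], []),
   ((0,-1,0), [(0,0), (0,1), (0,2), (1,1), (2,0), (2,1), (2,2)], [(0,0), (2,0)]),
   ((0,-1,1), [(0,0), (0,1), (0,2), (1,1), (2,0), (2,1), (2,2)], [(0,0), (0,1), (0,2), (1,1),
       (2,0), (2,1), (2,2)]),
   ((0,-1,2), [(0,0), (0,1), (2,0), (2,1)], [(0,0), (0,1), (2,0), (2,1)]),
   ((0,0,-2), [(0,2)], []),
   ((0,0,-1), [(0,0), (0,1), (0,2), (1,0), (1,1), (1,2), (2,2)], [(0,0), (0,1), (1,0), (1,1)]),
   ((0,0,0), [(0,0), (0,1), (0,2), (1,0), (1,1), (1,2), (2,0), (2,1), (2,2)], [(0,0), (0,1), (0,2),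
       (1,0), (1,1), (1,2), (2,0), (2,1), (2,2)]),
   ((0,0,1), [(0,0), (0,1), (0,2), (1,0), (1,1), (1,2), (2,0), (2,1), (2,2)], [(0,0), (0,1), (0,2),
       (1,0), (1,1), (1,2), (2,0), (2,1), (2,2)]),
   ((0,0,2), [(0,0), (1,0), (1,1), (2,0), (2,1)], [(0,0), (1,0), (1,1), (2,0), (2,1)]),
   ((0,1,-1), [(0,0), (0,1), (0,2), (1,0), (1,1), (1,2)], [(0,0), (0,1), (0,2), (1,0), (1,1),
       (1,2)]),
   ((0,1,0), [(0,0), (0,1), (0,2), (1,0), (1,1), (1,2), (2,0), (2,1), (2,2)], [(0,0), (0,1), (0,2),
       (1,0), (1,1), (1,2), (2,0), (2,1), (2,2)]),
   ((0,1,1), [(0,0), (1,0), (1,1), (1,2), (2,0), (2,1), (2,2)], [(0,0), (1,0), (1,1), (1,2), (2,0),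
       (2,1), (2,2)]),
   ((0,1,2), [(1,0), (2,0)], [(1,0)]),
   ((0,2,-1), [(0,0), (1,0), (1,2)], [(0,0), (1,0), (1,2)]),
   ((0,2,0), [(0,0), (1,0), (1,2), (2,0)], [(0,0), (1,0), (1,2), (2,0)]),
   ((0,2,1), [(1,0), (2,0)], []),
   ((1,-1,-1), [(0,1), (0,2)], [(0,1), (0,2)]),
   ((1,-1,0), [(0,0), (0,1), (0,2), (2,1)], [(0,0), (0,1), (0,2), (2,1)]),
   ((1,-1,1), [(0,0), (0,1), (0,2), (2,1)], [(0,0), (0,1), (0,2), (2,1)]),
   ((1,-1,2), [(0,0), (0,1), (2,1)], [(0,0), (0,1), (2,1)]),
   ((1,0,-1), [(0,0), (0,1), (0,2), (1,1), (1,2)], [(0,0), (0,1), (0,2), (1,1), (1,2)]),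
   ((1,0,0), [(0,0), (0,1), (0,2), (1,0), (1,1), (1,2), (2,0), (2,1), (2,2)], [(0,0), (0,1), (0,2),
       (1,0), (1,1), (1,2), (2,0), (2,1), (2,2)]),
   ((1,0,1), [(0,0), (0,1), (0,2), (1,0), (1,1), (1,2), (2,0), (2,1), (2,2)], [(0,0), (0,1), (0,2),
       (1,0), (1,1), (1,2), (2,0), (2,1), (2,2)]),
   ((1,0,2), [(0,0), (0,1), (1,0), (1,1), (2,0), (2,1)], [(0,0), (0,1)]),
   ((1,1,-1), [(0,0), (0,1), (0,2), (1,0), (1,1), (1,2)], [(0,0), (0,1), (0,2), (1,0), (1,1),
       (1,2)]),
   ((1,1,0), [(0,0), (0,1), (0,2), (1,0), (1,1), (1,2), (2,0), (2,1), (2,2)], [(0,0), (0,1), (0,2),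
       (1,0), (1,1), (1,2)]),
   ((1,2,-1), [(0,0), (0,2), (1,0), (1,2)], [(0,0), (0,2)]),
   ((1,2,0), [(0,0), (0,2), (1,0), (1,1), (1,2), (2,0), (2,2)], []),
   ((1,3,0), [(1,0)], []),
   ((2,-1,0), [(0,1)], [(0,1)]),
   ((2,-1,1), [(0,1)], [(0,1)]),
   ((2,-1,2), [(0,1)], []),
   ((2,0,-1), [(0,1), (0,2)], [(0,1), (0,2)]),
   ((2,0,0), [(0,0), (0,1), (0,2), (1,1), (2,1), (2,2)], [(0,0), (0,1), (0,2), (1,1)]),
   ((2,0,1), [(0,0), (0,1), (0,2), (1,1), (2,0), (2,1), (2,2)], []),
   ((2,0,2), [(0,0), (0,1), (1,1), (2,0), (2,1)], []),
   ((2,1,-1), [(0,0), (0,1), (0,2), (1,1), (1,2)], []),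
   ((2,1,0), [(0,0), (0,1), (0,2), (1,0), (1,1), (1,2), (2,0), (2,1), (2,2)], []),
   ((2,2,-1), [(0,0), (0,2), (1,0), (1,2)], []),
   ((2,2,0), [(0,0), (0,1), (0,2), (1,0), (1,1), (1,2), (2,0), (2,2)], []),
   ((2,3,0), [(0,0), (1,0), (1,2)], []),
   ((3,0,0), [(0,1), (0,2)], []),
   ((3,0,1), [(0,0), (0,1), (0,2), (2,1)], []),
   ((3,0,2), [(0,0), (0,1), (2,1)], []),
   ((3,1,-1), [(0,1), (0,2)], []),
   ((3,1,0), [(0,0), (0,1), (0,2), (1,1), (1,2), (2,1), (2,2)], []),
   ((3,2,-1), [(0,0), (0,2), (1,2)], []),
   ((3,2,0), [(0,0), (0,1), (0,2), (1,0), (1,1), (1,2), (2,0), (2,2)], []),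
   ((3,3,0), [(0,0), (0,2), (1,0), (1,1), (1,2)], []),
   ((3,4,0), [(1,0)], []),
   ((4,0,1), [(0,1)], []),
   ((4,0,2), [(0,1)], []),
   ((4,1,0), [(0,1), (0,2)], []),
   ((4,2,-1), [(0,2)], []),
   ((4,2,0), [(0,0), (0,1), (0,2), (1,1), (1,2), (2,2)], []),
   ((4,3,0), [(0,0), (0,1), (0,2), (1,0), (1,1), (1,2)], []),
   ((4,4,0), [(0,0), (1,0), (1,2)], []),
   ((5,2,0), [(0,1), (0,2)], []),
   ((5,3,0), [(0,0), (0,1), (0,2), (1,1), (1,2)], []),
   ((5,4,0), [(0,0), (0,2), (1,0), (1,2)], []),
   ((6,3,0), [(0,1), (0,2)], []),
   ((6,4,0), [(0,0), (0,2), (1,2)], []),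
   ((7,4,0), [(0,2)], [])]"

definition live :: "state list" where
  "live = concat (map (\<lambda>(r, _, hs). map (\<lambda>(a, b). (a, b, r)) hs) reach_table)"

text \<open>
  A rewrite step costs time proportional to the size of its redex.  Hence the data used in
  evaluations by rewriting are stored in balanced trees, and branching is done by matching on truth
  values, which, unlike \<open>if\<close>, does not have its branches traversed again.
\<close>

fun select :: "bool \<Rightarrow> 'a \<Rightarrow> 'a \<Rightarrow> 'a" where
  "select True x y = x"
| "select False x y = y"

datatype ('k, 'v) index = Cell 'v | Split 'k "('k, 'v) index" "('k, 'v) index"

function (sequential) fetch :: "'k::linorder \<Rightarrow> ('k, 'v) index \<Rightarrow> 'v"
  and fetch_from :: "bool \<Rightarrow> 'k \<Rightarrow> ('k, 'v) index \<Rightarrow> ('k, 'v) index \<Rightarrow> 'v" where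
  "fetch k (Cell v) = v"
| "fetch k (Split k' s t) = fetch_from (k < k') k s t"
| "fetch_from True k s t = fetch k s"
| "fetch_from False k s t = fetch k t"
  by pat_completeness auto
termination
  by (relation "measure (case_sum (\<lambda>(k, I). 2 * size I) (\<lambda>(b, k, s, t). 2 * (size s + size t) + 1))")
    auto

lemma fetch_in_set2_index: "fetch k I \<in> set2_index I"
proof (induction I)
  case (Split k' s t)
  then show ?case by (cases "k < k'") simp_all
qed simp

text \<open>For a list sorted by key, each tree is paired with its least key; a merged tree
  therefore splits at the least key of its right half.\<close>

fun pair_up :: "('k \<times> ('k, 'v) index) list \<Rightarrow> ('k \<times> ('k, 'v) index) list" where
  "pair_up ((k, s) # (k', t) # ts) = (k, Split k' s t) # pair_up ts"
| "pair_up ts = ts"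

text \<open>Every round halves the number of trees; seven rounds leave a single tree for up to 128
  rows, more than either table has.\<close>

definition index_of :: "('k \<times> 'v) list \<Rightarrow> ('k, 'v) index" where
  "index_of kvs = snd (hd ((pair_up ^^ 7) (map (map_prod id Cell) kvs)))"

text \<open>A lookup can thus only return a stored row, in whatever order the keys stand; that it
  returns the right row of \<open>reach_table\<close> is settled by evaluating
  \<open>row_ok\<close>.\<close>

lemma set2_index_of:
  assumes "kvs \<noteq> []"
  shows "set2_index (index_of kvs) \<subseteq> snd ` set kvs"
proof -
  have pair_up: "(\<Union>p \<in> set (pair_up ts). set2_index (snd p)) = (\<Union>p \<in> set ts. set2_index (snd p))"
    "pair_up ts = [] \<longleftrightarrow> ts = []" for ts :: "('a \<times> ('a, 'b) index) list"
    by (induction ts rule: pair_up.induct) auto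
  have "(\<Union>p \<in> set ((pair_up ^^ n) ts). set2_index (snd p)) = (\<Union>p \<in> set ts. set2_index (snd p)) \<and>
      ((pair_up ^^ n) ts = [] \<longleftrightarrow> ts = [])" for n and ts :: "('a \<times> ('a, 'b) index) list"
    by (induction n) (simp_all add: pair_up)
  from this[of 7 "map (map_prod id Cell) kvs"] assms
  have "(\<Union>p \<in> set ((pair_up ^^ 7) (map (map_prod id Cell) kvs)). set2_index (snd p)) = snd ` set kvs"
    "(pair_up ^^ 7) (map (map_prod id Cell) kvs) \<noteq> []"
    by auto
  then show ?thesis unfolding index_of_def using hd_in_set by blast
qed

text \<open>
  The rows are sorted by this key.  A collision of keys would be harmless, as \<open>row_match\<close> compares
  the vectors themselves.
\<close>

fun vec_key :: "vec \<Rightarrow> int" where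
  "vec_key (x, y, z) = 100 * x + 10 * y + z"

type_synonym reach_index = "(int, vec \<times> (nat \<times> nat) list \<times> (nat \<times> nat) list) index"

definition reach_index :: reach_index where
  "reach_index = index_of (map (\<lambda>row. (vec_key (fst row), row)) reach_table)"

fun row_match :: "vec \<Rightarrow> vec \<times> 'b \<Rightarrow> 'b option" where
  "row_match r (r', v) = select (r = r') (Some v) None"

lemma row_match_eq_Some: "row_match r row = Some v \<longleftrightarrow> row = (r, v)"
  by (cases row; cases "r = fst row") auto

text \<open>\<open>l\<close> says whether the source of the edge is live: the sets \<open>ps\<close>
  must be closed forwards up to escape, the sets \<open>hs\<close> backwards.\<close>

fun edge_ok :: "reach_index \<Rightarrow> bool \<Rightarrow> state \<Rightarrow> bool" where
  "edge_ok I l (a, b, r) \<longleftrightarrow>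
     (case row_match r (fetch (vec_key r) I) of
        None \<Rightarrow> escaping r
      | Some (ps, hs) \<Rightarrow> (a, b) \<in> set ps \<and> ((a, b) \<in> set hs \<longrightarrow> l))"

fun pair_ok :: "reach_index \<Rightarrow> vec \<Rightarrow> (nat \<times> nat) list \<Rightarrow> nat \<times> nat \<Rightarrow> bool" where
  "pair_ok I r hs (a, b) \<longleftrightarrow>
     list_all (edge_ok I ((a, b) \<in> set hs)) (succs 0 (a, b, r) @ succs 1 (a, b, r))"

fun row_ok :: "reach_index \<Rightarrow> vec \<times> (nat \<times> nat) list \<times> (nat \<times> nat) list \<Rightarrow> bool" where
  "row_ok I (r, ps, hs) \<longleftrightarrow> row_match r (fetch (vec_key r) I) = Some (ps, hs) \<and>
     \<not> escaping r \<and> (weight r = 0 \<longrightarrow> ps = hs) \<and> list_all (pair_ok I r hs) ps"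

lemma rows_ok: "list_all (row_ok reach_index) reach_table"
  by code_simp

section \<open>From the checked table to all reachable states\<close>

definition entry :: "vec \<Rightarrow> (nat \<times> nat) list \<times> (nat \<times> nat) list" where
  "entry r = (case row_match r (fetch (vec_key r) reach_index) of None \<Rightarrow> ([], []) | Some e \<Rightarrow> e)"

lemma row_in_reach_table:
  assumes "row_match r (fetch (vec_key r) reach_index) = Some e"
  shows "(r, e) \<in> set reach_table"
proof -
  have "(r, e) \<in> set2_index reach_index"
    using fetch_in_set2_index[of "vec_key r" reach_index] assms by (simp add: row_match_eq_Some)
  moreover have "reach_table \<noteq> []" by (simp add: reach_table_def)
  then have "set2_index reach_index \<subseteq> set reach_table"
    using set2_index_of[of "map (\<lambda>row. (vec_key (fst row), row)) reach_table"]
    by (auto simp: reach_index_def)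
  ultimately show ?thesis by blast
qed

lemma entry_in_reach_table:
  assumes "fst (entry r) \<noteq> [] \<or> snd (entry r) \<noteq> []"
  shows "(r, entry r) \<in> set reach_table"
  using assms row_in_reach_table[of r] by (auto simp: entry_def split: option.splits)

lemma entry_eq: "(r, e) \<in> set reach_table \<Longrightarrow> entry r = e"
  using rows_ok by (cases e) (auto simp: list_all_iff entry_def)

lemma set_live: "(a, b, r) \<in> set live \<longleftrightarrow> (a, b) \<in> set (snd (entry r))"
proof
  assume "(a, b, r) \<in> set live"
  then obtain ps hs where "(r, ps, hs) \<in> set reach_table" "(a, b) \<in> set hs"
    by (auto simp: live_def)
  then show "(a, b) \<in> set (snd (entry r))" using entry_eq by fastforce
next
  assume *: "(a, b) \<in> set (snd (entry r))"
  then have "(r, entry r) \<in> set reach_table" by (intro entry_in_reach_table) auto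
  moreover obtain ps hs where e: "entry r = (ps, hs)" by (cases "entry r")
  ultimately have "(r, ps, hs) \<in> set reach_table" "(a, b) \<in> set hs" using * by simp_all
  then show "(a, b, r) \<in> set live"
    unfolding live_def set_concat set_map by (intro UN_I[OF imageI[of "(r, ps, hs)"]]) force+
qed

fun reachable :: "state \<Rightarrow> bool" where
  "reachable (a, b, r) \<longleftrightarrow> escaping r \<or> (a, b) \<in> set (fst (entry r))"

lemma escaping_not_live:
  assumes "escaping r"
  shows "(a, b, r) \<notin> set live"
proof
  assume "(a, b, r) \<in> set live"
  then have "(r, entry r) \<in> set reach_table"
    by (intro entry_in_reach_table) (auto simp: set_live)
  then show False using rows_ok assms by (cases "entry r") (auto simp: list_all_iff)
qed

text \<open>On the positive side the sum is at least 3, so the new coordinate is at least 1. On the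
  negative side the three pair bounds add up to \<open>2 * (x + y + z) \<le> -3\<close>; by
  integrality the sum is at most -2 and the new coordinate at most -1.\<close>

lemma escaping_advance:
  assumes "escaping r" "-2 \<le> k" "k \<le> 1"
  shows "escaping (advance k r)"
  using assms by (cases r) auto

text \<open>Escaping states stay escaping and are never live; for the others both closure properties
  come from the evaluated table.\<close>

lemma reachable_succs:
  assumes "reachable q" "c \<in> {0, 1}" "q' \<in> set (succs c q)"
  shows "reachable q'" and "q' \<in> set live \<Longrightarrow> q \<in> set live"
proof -
  obtain a b r where q: "q = (a, b, r)" by (cases q)
  obtain a' b' r' where q': "q' = (a', b', r')" by (cases q')
  have "reachable q' \<and> (q' \<in> set live \<longrightarrow> q \<in> set live)"
  proof (cases "escaping r")
    case True
    obtain d e where "(d, a') \<in> set (children a)" "(e, b') \<in> set (children b)"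
      "r' = advance (e - d - c) r"
      using assms(3) q q' by auto
    moreover from this have "d \<in> {0, 1}" "e \<in> {0, 1}"
      by (auto simp: children_def split: if_splits)
    ultimately have "escaping r'" using escaping_advance[OF True, of "e - d - c"] assms(2) by auto
    then show ?thesis using q' escaping_not_live by simp
  next
    case False
    then have ab: "(a, b) \<in> set (fst (entry r))" using assms(1) q by simp
    then have "(r, entry r) \<in> set reach_table" by (intro entry_in_reach_table) auto
    then have "pair_ok reach_index r (snd (entry r)) (a, b)"
      using rows_ok ab by (cases "entry r") (auto simp: list_all_iff simp del: pair_ok.simps)
    moreover have "q' \<in> set (succs 0 (a, b, r) @ succs 1 (a, b, r))"
      using assms(2,3) q by (auto simp del: succs.simps)
    ultimately have "edge_ok reach_index ((a, b) \<in> set (snd (entry r))) q'"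
      by (simp only: pair_ok.simps list_all_iff)
    then show ?thesis
      using q q' by (auto simp: set_live entry_def split: option.splits)
  qed
  then show "reachable q'" and "q' \<in> set live \<Longrightarrow> q \<in> set live" by simp_all
qed

text \<open>Escaping vectors have nonzero coordinate sum, and rows of coordinate sum 0 have
  \<open>ps = hs\<close>. Hence no factor is lost by keeping only live states.\<close>

lemma reachable_balanced:
  assumes "reachable (a, b, r)" "weight r = 0"
  shows "(a, b, r) \<in> set live"
proof -
  have "\<not> escaping r" using assms(2) by (cases r) auto
  then have ab: "(a, b) \<in> set (fst (entry r))" using assms(1) by simp
  then have "(r, entry r) \<in> set reach_table" by (intro entry_in_reach_table) auto
  then have "fst (entry r) = snd (entry r)"
    using rows_ok assms(2) by (cases "entry r") (auto simp: list_all_iff)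
  with ab show ?thesis by (simp add: set_live)
qed

lemma start_live: "(0, 0, 0, 0, 0) \<in> set live"
  by code_simp

lemma reachable_start: "reachable (0, 0, 0, 0, 0)"
proof -
  have "(0, 0) \<in> set (snd (entry (0, 0, 0)))" using start_live by (simp add: set_live)
  moreover from this have "((0, 0, 0), entry (0, 0, 0)) \<in> set reach_table"
    by (intro entry_in_reach_table) auto
  then have "fst (entry (0, 0, 0)) = snd (entry (0, 0, 0))"
    using rows_ok by (cases "entry (0, 0, 0)") (auto simp: list_all_iff)
  ultimately show ?thesis by simp
qed

lemma reachable_run:
  assumes "\<forall>q\<in>Q. reachable q" "set w \<subseteq> {0, 1}" "q \<in> run w Q"
  shows "reachable q"
  using assms
proof (induction w arbitrary: Q)
  case (Cons c w)
  have "int c \<in> {0, 1}" using Cons.prems(2) by auto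
  then have "\<forall>q \<in> (\<Union>q\<in>Q. set (succs (int c) q)). reachable q"
    using Cons.prems(1) reachable_succs(1) by (metis UN_E)
  then show ?case
    using Cons.IH[of "\<Union>q\<in>Q. set (succs (int c) q)"] Cons.prems(2,3) by simp
qed simp

fun live_run :: "nat list \<Rightarrow> state set \<Rightarrow> state set" where
  "live_run [] Q = Q"
| "live_run (c # w) Q = live_run w ((\<Union>q\<in>Q. set (succs (int c) q)) \<inter> set live)"

lemma live_run_append: "live_run (v @ w) Q = live_run w (live_run v Q)"
  by (induction v arbitrary: Q) simp_all

text \<open>A live successor has a live source, so discarding the other states after every digit
  leaves the same live states as discarding them at the end.\<close>

lemma live_run_eq:
  assumes "\<forall>q\<in>Q. reachable q" "set w \<subseteq> {0, 1}"
  shows "live_run w (Q \<inter> set live) = run w Q \<inter> set live"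
  using assms
proof (induction w arbitrary: Q)
  case (Cons c w)
  define Q' where "Q' = (\<Union>q\<in>Q. set (succs (int c) q))"
  have c: "int c \<in> {0, 1}" using Cons.prems(2) by auto
  have "(\<Union>q \<in> Q \<inter> set live. set (succs (int c) q)) \<inter> set live = Q' \<inter> set live"
    unfolding Q'_def using reachable_succs(2)[OF _ c] Cons.prems(1) by blast
  moreover have "\<forall>q\<in>Q'. reachable q"
    unfolding Q'_def using Cons.prems(1) reachable_succs(1)[OF _ c] by blast
  ultimately show ?case using Cons.IH[of Q'] Cons.prems(2) by (simp add: Q'_def)
qed simp

section \<open>The subset automaton\<close>

datatype 'a tree = Leaf 'a | Branch "'a tree" "'a tree"

fun leaves :: "'a tree \<Rightarrow> 'a list" where
  "leaves (Leaf q) = [q]"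
| "leaves (Branch s t) = leaves s @ leaves t"

lemma set_leaves: "set (leaves t) = set_tree t"
  by (induction t) simp_all

fun merge :: "'a tree list \<Rightarrow> 'a tree list" where
  "merge (s # t # ts) = Branch s t # merge ts"
| "merge ts = ts"

text \<open>Eight rounds of halving reach a single tree for up to 256 states;
  \<open>leaves_live_tree\<close> confirms that none is lost.\<close>

definition live_tree :: "state tree" where
  "live_tree = hd ((merge ^^ 8) (map Leaf live))"

lemma leaves_live_tree: "leaves live_tree = live"
  by code_simp

lemma set_live_tree: "set_tree live_tree = set live"
  using set_leaves[of live_tree] by (simp add: leaves_live_tree)

text \<open>
  A subset of the leaves of a tree is coded by the part of the tree that leads to its elements.
  \<open>Fork Off Off\<close> marks a leaf, so that no code is ill-formed and \<open>join\<close> is union over every tree;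
  \<open>fork\<close> keeps the codes canonical.
\<close>

datatype sub = Off | Fork sub sub

fun elems :: "'a tree \<Rightarrow> sub \<Rightarrow> 'a set" where
  "elems t Off = {}"
| "elems (Leaf q) (Fork X Y) = {q}"
| "elems (Branch s t) (Fork X Y) = elems s X \<union> elems t Y"

fun join :: "sub \<Rightarrow> sub \<Rightarrow> sub" where
  "join Off Z = Z"
| "join (Fork X Y) Off = Fork X Y"
| "join (Fork X Y) (Fork X' Y') = Fork (join X X') (join Y Y')"

fun fork :: "sub \<Rightarrow> sub \<Rightarrow> sub" where
  "fork Off Off = Off"
| "fork Off (Fork X Y) = Fork Off (Fork X Y)"
| "fork (Fork X Y) Z = Fork (Fork X Y) Z"

lemma elems_join: "elems t (join X Y) = elems t X \<union> elems t Y"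
proof (induction X Y arbitrary: t rule: join.induct)
  case (3 X Y X' Y')
  then show ?case by (cases t) auto
qed simp_all

lemma elems_fork: "elems (Branch s t) (fork X Y) = elems s X \<union> elems t Y"
  by (cases "(X, Y)" rule: fork.cases) auto

fun encode :: "'a list \<Rightarrow> 'a tree \<Rightarrow> sub" where
  "encode S (Leaf q) = select (q \<in> set S) (Fork Off Off) Off"
| "encode S (Branch s t) = fork (encode S s) (encode S t)"

lemma elems_encode: "elems t (encode S t) = set S \<inter> set_tree t"
proof (induction t)
  case (Leaf q)
  then show ?case by (cases "q \<in> set S") auto
qed (auto simp: elems_fork)

text \<open>Each leaf of the tree stores the code of the successors of one state, so a step of the
  subset automaton is a union of stored codes.\<close>

fun image_code :: "sub tree \<Rightarrow> sub \<Rightarrow> sub" where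
  "image_code t Off = Off"
| "image_code (Leaf m) (Fork X Y) = m"
| "image_code (Branch s t) (Fork X Y) = join (image_code s X) (image_code t Y)"

lemma elems_image_code:
  "elems t (image_code (map_tree f s) X) = (\<Union>q \<in> elems s X. elems t (f q))"
  by (induction s X rule: elems.induct) (auto simp: elems_join)

fun succ_code :: "int \<Rightarrow> state tree \<Rightarrow> state \<Rightarrow> sub" where
  "succ_code c t q = encode (succs c q) t"

abbreviation live_step :: "int \<Rightarrow> sub tree" where
  "live_step c \<equiv> map_tree (succ_code c live_tree) live_tree"

text \<open>Encoding along \<open>live_tree\<close> already discards successors that are not live,
  so this is one step of \<open>live_run\<close>.\<close>

lemma elems_live_step:
  "elems live_tree (image_code (live_step c) X) =
     (\<Union>q \<in> elems live_tree X. set (succs c q)) \<inter> set live"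
  by (auto simp: elems_image_code elems_encode set_live_tree)

text \<open>The quantity \<open>|u|_1 + 2|u|_2\<close> of additive equivalence, on Parikh
  vectors.\<close>

fun score :: "vec \<Rightarrow> int" where
  "score (x, y, z) = y + 2 * z"

fun balanced_with :: "int \<Rightarrow> state \<Rightarrow> bool" where
  "balanced_with s (a, b, r) \<longleftrightarrow> weight r = 0 \<and> score r = s"

fun has :: "bool tree \<Rightarrow> sub \<Rightarrow> bool" where
  "has t Off \<longleftrightarrow> False"
| "has (Leaf b) (Fork X Y) \<longleftrightarrow> b"
| "has (Branch s t) (Fork X Y) \<longleftrightarrow> has s X \<or> has t Y"

lemma has_map_tree: "has (map_tree P t) X \<longleftrightarrow> (\<exists>q \<in> elems t X. P q)"
  by (induction t X rule: elems.induct) auto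

fun count_has :: "bool tree list \<Rightarrow> sub \<Rightarrow> nat" where
  "count_has [] X = 0"
| "count_has (t # ts) X = select (has t X) 1 0 + count_has ts X"

text \<open>No other score occurs among live vectors of coordinate sum 0, as
  \<open>live_score_small\<close> checks.\<close>

definition score_trees :: "state tree \<Rightarrow> bool tree list" where
  "score_trees t = map (\<lambda>s. map_tree (balanced_with s) t) [-2, -1, 0, 1, 2, 3]"

fun score_small :: "state \<Rightarrow> bool" where
  "score_small (a, b, r) \<longleftrightarrow> weight r \<noteq> 0 \<or> score r \<in> set [-2, -1, 0, 1, 2, 3]"

lemma live_score_small: "list_all score_small live"
  by code_simp

lemma count_has_score_trees:
  "count_has (score_trees live_tree) X =
     card {s. \<exists>q \<in> elems live_tree X. balanced_with s q}"
proof -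
  have count: "count_has (map (\<lambda>s. map_tree (balanced_with s) t) ss) X =
      card {s \<in> set ss. \<exists>q \<in> elems t X. balanced_with s q}" if "distinct ss" for ss and t :: "state tree"
    using that
  proof (induction ss)
    case (Cons s ss)
    have "{s' \<in> set (s # ss). \<exists>q \<in> elems t X. balanced_with s' q} =
      (if has (map_tree (balanced_with s) t) X then insert s else id)
        {s' \<in> set ss. \<exists>q \<in> elems t X. balanced_with s' q}"
      by (auto simp: has_map_tree)
    with Cons show ?case by (cases "has (map_tree (balanced_with s) t) X") simp_all
  qed simp
  have sub: "elems t X \<subseteq> set_tree t" for t :: "state tree"
    by (induction t X rule: elems.induct) auto
  have "s \<in> set [-2, -1, 0, 1, 2, 3]" if "q \<in> elems live_tree X" "balanced_with s q" for s q
  proof -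
    have "score_small q"
      using live_score_small that(1) sub[of live_tree] by (auto simp: list_all_iff set_live_tree)
    then show ?thesis using that(2) by (cases q) auto
  qed
  then have "{s. \<exists>q \<in> elems live_tree X. balanced_with s q} =
      {s \<in> set [-2, -1, 0, 1, 2, 3]. \<exists>q \<in> elems live_tree X. balanced_with s q}"
    by blast
  then show ?thesis unfolding score_trees_def by (subst count) simp_all
qed

section \<open>The automaton with 76 states\<close>

text \<open>
  The rows are (state, output, successor on 0, successor on 1).  As \<open>111\<close> does not occur in a
  representation, the last entry is irrelevant after \<open>11\<close>; it is the state itself there.
\<close>

definition dfa_table :: "(nat \<times> nat \<times> nat \<times> nat) list" where
  "dfa_table = [
   (0, 1, 0, 1), (1, 3, 2, 3), (2, 3, 4, 5), (3, 3, 6, 3), (4, 3, 7, 8), (5, 4, 9, 10),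
   (6, 4, 11, 5), (7, 3, 6, 12), (8, 3, 13, 14), (9, 4, 15, 5), (10, 3, 16, 10), (11, 4, 17, 18),
   (12, 3, 6, 3), (13, 3, 4, 19), (14, 3, 20, 14), (15, 3, 21, 22), (16, 4, 11, 19), (17, 3, 20, 23),
   (18, 3, 16, 14), (19, 4, 9, 24), (20, 4, 25, 26), (21, 4, 27, 18), (22, 4, 28, 14), (23, 4, 27, 10),
   (24, 3, 29, 24), (25, 5, 30, 18), (26, 4, 28, 31), (27, 5, 32, 5), (28, 4, 15, 19), (29, 4, 33, 34),
   (30, 4, 35, 23), (31, 3, 36, 31), (32, 4, 37, 38), (33, 4, 17, 39), (34, 4, 40, 41), (35, 4, 42, 26),
   (36, 4, 25, 43), (37, 4, 44, 45), (38, 4, 46, 14), (39, 3, 29, 47), (40, 5, 48, 49), (41, 4, 50, 41),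
   (42, 5, 51, 18), (43, 4, 28, 52), (44, 5, 53, 26), (45, 4, 46, 31), (46, 5, 32, 19), (47, 4, 35, 47),
   (48, 3, 21, 54), (49, 5, 30, 10), (50, 4, 33, 55), (51, 5, 56, 23), (52, 3, 57, 52), (53, 5, 58, 38),
   (54, 4, 59, 60), (55, 4, 40, 61), (56, 4, 62, 45), (57, 4, 63, 64), (58, 4, 65, 45), (59, 4, 48, 66),
   (60, 4, 67, 60), (61, 4, 68, 61), (62, 5, 62, 45), (63, 5, 30, 39), (64, 4, 69, 70), (65, 5, 71, 26),
   (66, 5, 30, 24), (67, 4, 25, 72), (68, 4, 33, 64), (69, 5, 48, 66), (70, 4, 57, 70), (71, 5, 62, 38),
   (72, 4, 59, 73), (73, 4, 74, 73), (74, 4, 25, 75), (75, 4, 59, 70)]"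

type_synonym dfa_index = "(nat, nat \<times> nat \<times> nat) index"

definition dfa_index :: dfa_index where
  "dfa_index = index_of dfa_table"

text \<open>
  A configuration consists of a state of the automaton, the number of trailing ones read so far and
  the code of the reachable set.
\<close>

type_synonym config = "nat \<times> nat \<times> sub"

text \<open>Visited configurations are grouped by automaton state, so that the test for a repetition
  searches a single cell.\<close>

function (sequential) add :: "config \<Rightarrow> (nat, config list) index \<Rightarrow> (nat, config list) index"
  and add_from :: "bool \<Rightarrow> config \<Rightarrow> nat \<Rightarrow> (nat, config list) index \<Rightarrow>
    (nat, config list) index \<Rightarrow> (nat, config list) index" where
  "add C (Cell Cs) = Cell (C # Cs)"
| "add C (Split k s t) = add_from (fst C < k) C k s t"
| "add_from True C k s t = Split k (add C s) t"
| "add_from False C k s t = Split k s (add C t)"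
  by pat_completeness auto
termination
  by (relation
      "measure (case_sum (\<lambda>(C, I). 2 * size I) (\<lambda>(b, C, k, s, t). 2 * (size s + size t) + 1))")
    auto

definition configs :: "(nat, config list) index \<Rightarrow> config set" where
  "configs I = (\<Union>Cs \<in> set2_index I. set Cs)"

lemma configs_add: "configs (add C I) = insert C (configs I)"
proof (induction I)
  case (Split k s t)
  then show ?case by (cases "fst C < k") (auto simp: configs_def)
qed (simp add: configs_def)

fun config_succs :: "sub tree \<Rightarrow> sub tree \<Rightarrow> sub \<Rightarrow> nat \<Rightarrow> nat \<times> nat \<times> nat \<Rightarrow> config list" where
  "config_succs M0 M1 X t (v, q0, q1) =
     (q0, 0, image_code M0 X) # select (t = 2) [] [(q1, t + 1, image_code M1 X)]"

type_synonym progress = "bool \<times> (nat, config list) index \<times> config list"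

fun visit :: "bool \<Rightarrow> sub tree \<Rightarrow> sub tree \<Rightarrow> bool tree list \<Rightarrow> config \<Rightarrow> nat \<times> nat \<times> nat \<Rightarrow>
    progress \<Rightarrow> progress" where
  "visit True M0 M1 V C row S = S"
| "visit False M0 M1 V (q, t, X) row (ok, I, todo) =
     (ok \<and> fst row = count_has V X, add (q, t, X) I, config_succs M0 M1 X t row @ todo)"

fun explore_step :: "sub tree \<Rightarrow> sub tree \<Rightarrow> bool tree list \<Rightarrow> dfa_index \<Rightarrow> progress \<Rightarrow> progress" where
  "explore_step M0 M1 V D (ok, I, []) = (ok, I, [])"
| "explore_step M0 M1 V D (ok, I, C # todo) =
     visit (C \<in> set (fetch (fst C) I)) M0 M1 V C (fetch (fst C) D) (ok, I, todo)"

text \<open>With a list of length \<open>k\<close>, this performs \<open>2 ^ k\<close> steps.\<close>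

fun explore :: "unit list \<Rightarrow> sub tree \<Rightarrow> sub tree \<Rightarrow> bool tree list \<Rightarrow> dfa_index \<Rightarrow> progress \<Rightarrow> progress" where
  "explore [] M0 M1 V D S = explore_step M0 M1 V D S"
| "explore (u # us) M0 M1 V D S = explore us M0 M1 V D (explore us M0 M1 V D S)"

fun finished :: "progress \<Rightarrow> bool" where
  "finished (ok, I, todo) \<longleftrightarrow> ok \<and> todo = []"

text \<open>The \<open>2 ^ 9 = 512\<close> steps exhaust the worklist, which \<open>finished\<close>
  verifies. The store starts with empty cells and the split keys of \<open>D\<close>.\<close>

fun check_from :: "sub tree \<Rightarrow> sub tree \<Rightarrow> bool tree list \<Rightarrow> dfa_index \<Rightarrow> sub \<Rightarrow> bool" where
  "check_from M0 M1 V D X \<longleftrightarrow> image_code M0 X = X \<and>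
     finished (explore (replicate 9 ()) M0 M1 V D (True, map_index id (\<lambda>_. []) D, [(0, 0, X)]))"

text \<open>
  The representations of \<open>i\<close> and \<open>j\<close> may be longer than that of \<open>n\<close>, which is then padded by zeros.  The
  set reached by padding with zeros is stable from six zeros on.
\<close>

fun check_steps :: "sub tree \<Rightarrow> sub tree \<Rightarrow> bool tree list \<Rightarrow> dfa_index \<Rightarrow> sub \<Rightarrow> bool" where
  "check_steps M0 M1 V D X = check_from M0 M1 V D ((image_code M0 ^^ 6) X)"

fun check_tree :: "state tree \<Rightarrow> dfa_index \<Rightarrow> bool" where
  "check_tree t D = check_steps (map_tree (succ_code 0 t) t) (map_tree (succ_code 1 t) t)
     (score_trees t) D (encode [(0, 0, 0, 0, 0)] t)"

lemma check_live_tree: "check_tree live_tree dfa_index"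
  by code_simp

section \<open>Soundness of the search\<close>

definition initial_code :: sub where
  "initial_code = (image_code (live_step 0) ^^ 6) (encode [(0, 0, 0, 0, 0)] live_tree)"

fun row_succs :: "config \<Rightarrow> config list" where
  "row_succs (q, t, X) = config_succs (live_step 0) (live_step 1) X t (fetch q dfa_index)"

fun row_correct :: "config \<Rightarrow> bool" where
  "row_correct (q, t, X) \<longleftrightarrow> fst (fetch q dfa_index) = count_has (score_trees live_tree) X"

text \<open>Whatever a recorded configuration leads to is recorded or pending; once nothing is
  pending, the recorded configurations are closed under successors.\<close>

fun invariant :: "config \<Rightarrow> progress \<Rightarrow> bool" where
  "invariant C0 (ok, I, todo) \<longleftrightarrow> C0 \<in> configs I \<union> set todo \<and>
     (\<forall>C \<in> configs I. (ok \<longrightarrow> row_correct C) \<and> set (row_succs C) \<subseteq> configs I \<union> set todo)"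

lemma invariant_explore_step:
  assumes "invariant C0 S"
  shows "invariant C0
    (explore_step (live_step 0) (live_step 1) (score_trees live_tree) dfa_index S)"
proof (cases S)
  case (fields ok I todo)
  show ?thesis
  proof (cases todo)
    case Nil
    then show ?thesis using assms fields by simp
  next
    case (Cons C todo')
    obtain q t X where C: "C = (q, t, X)" by (cases C)
    show ?thesis
    proof (cases "C \<in> set (fetch (fst C) I)")
      case True
      then have "C \<in> configs I" using fetch_in_set2_index by (force simp: configs_def)
      then show ?thesis using assms fields Cons True by auto
    next
      case False
      then show ?thesis using assms fields Cons C
        by (auto simp: configs_add simp del: config_succs.simps)
    qed
  qed
qed

lemma invariant_explore:
  "invariant C0 S \<Longrightarrow>
   invariant C0 (explore us (live_step 0) (live_step 1) (score_trees live_tree) dfa_index S)"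
  by (induction us arbitrary: S) (simp_all add: invariant_explore_step)

lemma initial_code_fixed: "image_code (live_step 0) initial_code = initial_code"
  using check_live_tree by (simp add: initial_code_def del: funpow.simps)

text \<open>The witness is the set of configurations recorded by the finished search.\<close>

lemma ex_bisimulation:
  "\<exists>Z. (0, 0, initial_code) \<in> Z \<and> (\<forall>C\<in>Z. row_correct C \<and> set (row_succs C) \<subseteq> Z)"
proof -
  define S :: progress where "S = (True, map_index id (\<lambda>_. []) dfa_index, [(0, 0, initial_code)])"
  have "configs (map_index id (\<lambda>_. []) D) = {}" for D :: dfa_index
    by (auto simp: configs_def index.set_map)
  then have "invariant (0, 0, initial_code) S" by (simp add: S_def)
  then have "invariant (0, 0, initial_code) (explore (replicate 9 ()) (live_step 0) (live_step 1)
      (score_trees live_tree) dfa_index S)" (is "invariant _ ?E")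
    by (rule invariant_explore)
  moreover have "finished ?E"
    using check_live_tree by (simp add: S_def initial_code_def del: funpow.simps)
  moreover obtain ok I todo where "?E = (ok, I, todo)" by (cases ?E)
  ultimately show ?thesis by (intro exI[of _ "configs I"]) auto
qed

section \<open>Correctness of the automaton\<close>

definition dfa_step :: "nat \<Rightarrow> nat \<Rightarrow> nat" where
  "dfa_step q c = (case fetch q dfa_index of (v, q0, q1) \<Rightarrow> if c = 0 then q0 else q1)"

definition dfa_out :: "nat \<Rightarrow> nat" where
  "dfa_out q = fst (fetch q dfa_index)"

text \<open>The letter tracked by \<open>valid\<close> is the number of trailing ones in the
  configuration, so each digit of a valid word selects a successor that lies in
  \<open>Z\<close>.\<close>

lemma bisimulation_valid:
  assumes Z: "\<forall>C\<in>Z. set (row_succs C) \<subseteq> Z"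
  shows "(q, t, X) \<in> Z \<Longrightarrow> t \<le> 2 \<Longrightarrow> valid t w \<Longrightarrow>
    \<exists>t' X'. (foldl dfa_step q w, t', X') \<in> Z \<and>
      elems live_tree X' = live_run w (elems live_tree X)"
proof (induction w arbitrary: q t X)
  case (Cons c w)
  obtain v q0 q1 where row: "fetch q dfa_index = (v, q0, q1)" by (cases "fetch q dfa_index")
  have sub: "set (config_succs (live_step 0) (live_step 1) X t (v, q0, q1)) \<subseteq> Z"
    using bspec[OF Z Cons.prems(1)] row by (simp del: config_succs.simps)
  from Cons.prems(3) obtain t' where t': "(int c, t') \<in> set (children t)" "valid t' w" by auto
  have "(dfa_step q c, t', image_code (live_step (int c)) X) \<in> Z \<and> t' \<le> 2"
  proof (cases "c = 0")
    case True
    then have "t' = 0" using t'(1) by (auto simp: children_def split: if_splits)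
    then show ?thesis using True sub row by (simp add: dfa_step_def)
  next
    case False
    then have "c = 1" "t \<noteq> 2" "t' = t + 1" "t' \<le> 2"
      using t'(1) by (auto simp: children_def split: if_splits)
    then show ?thesis using sub row by (simp add: dfa_step_def)
  qed
  from Cons.IH[OF conjunct1[OF this] conjunct2[OF this] t'(2)]
  show ?case by (simp add: elems_live_step)
qed auto

section \<open>Greedy representations and prefixes of the word\<close>

lemma trib_strict_mono: "strict_mono trib"
  by (simp add: strict_mono_Suc_iff trib_less_Suc)

lemma length_greedy_digits [simp]: "length (greedy_digits k n) = k"
  by (induction k arbitrary: n) simp_all

lemma greedy_digits_trib_rep: "greedy_digits (length (trib_rep n)) n = trib_rep n"
  by (simp add: trib_rep_def)

lemma greedy_digits_leading_zeros:
  assumes "n < trib k"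
  shows "greedy_digits (j + k) n = replicate j 0 @ greedy_digits k n"
proof (induction j)
  case (Suc j)
  have "n < trib (j + k)"
    using assms strict_mono_less_eq[OF trib_strict_mono, of k "j + k"] by simp
  with Suc show ?case by simp
qed simp

text \<open>The leading 1 forces \<open>trib k \<le> n\<close>, which makes \<open>Suc k\<close> the
  least admissible length.\<close>

lemma greedy_digits_eq_trib_rep:
  assumes "greedy_digits (Suc k) n = 1 # w" "n < trib (Suc k)"
  shows "trib_rep n = 1 # w"
proof -
  have "trib k \<le> n" using assms(1) by (auto intro: leI)
  then have "\<not> n < trib j" if "j < Suc k" for j
    using strict_mono_less_eq[OF trib_strict_mono, of j k] that by simp
  then have "Suc k \<le> j" if "n < trib j" for j using that not_less by blast
  then have "(LEAST j. n < trib j) = Suc k" using assms(2) by (intro Least_equality)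
  then show ?thesis using assms(1) by (simp add: trib_rep_def)
qed

lemma trib_rep_leading_one:
  assumes "1 \<le> n"
  shows "\<exists>w. trib_rep n = 1 # w"
proof -
  obtain k where k: "(LEAST k. n < trib k) = Suc k"
    using LeastI[of "\<lambda>k. n < trib k", OF trib_gt] assms by (cases "LEAST k. n < trib k") auto
  then have "trib k \<le> n" using not_less_Least[of k "\<lambda>k. n < trib k"] by simp
  then have "n div trib k \<noteq> 0" using trib_pos[of k] by (simp add: div_eq_0_iff not_less)
  moreover have rep: "trib_rep n = n div trib k # greedy_digits k (n mod trib k)"
    by (simp add: trib_rep_def k)
  then have "n div trib k \<in> {0, 1}" using set_trib_rep[of n] by simp
  ultimately show ?thesis using rep by simp
qed

lemma valid_trib_rep: "valid 0 (trib_rep n)"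
proof -
  have "n < length (block (length (trib_rep n)) 0)"
    by (simp add: length_block_0 trib_rep_length)
  from valid_greedy_digits[OF this] show ?thesis unfolding greedy_digits_trib_rep .
qed

lemma stake_tr:
  assumes "i \<le> trib k"
  shows "take i (block k 0) = stake i tr"
proof -
  obtain v where "tr = block k 0 @- v"
    using trib_fixed_point_prefix[OF morph_image_tr shd_tr, of k] unfolding block_def by blast
  then have "stake i tr = take i (block k 0) @ stake (i - trib k) v"
    by (metis stake_shift length_block_0)
  then show ?thesis using assms by simp
qed

section \<open>Scores of factors as differences of prefix scores\<close>

lemma weight_add: "weight (u + v) = weight u + weight v"
  by (cases u; cases v) simp

lemma weight_diff: "weight (u - v) = weight u - weight v"
  by (cases u; cases v) simp

lemma score_add: "score (u + v) = score u + score v"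
  by (cases u; cases v) simp

lemma score_diff: "score (u - v) = score u - score v"
  by (cases u; cases v) simp

lemma weight_parikh: "weight (parikh u) = int (length u)"
  by (induction u) (simp_all add: zero_prod_def weight_add unit_vec_def)

lemma score_parikh:
  "set u \<subseteq> {0, 1, 2} \<Longrightarrow> score (parikh u) = int (count_list u 1 + 2 * count_list u 2)"
  by (induction u) (auto simp: zero_prod_def score_add unit_vec_def)

lemma card_quotient_kernel:
  "card (A // {(u, v). u \<in> A \<and> v \<in> A \<and> f u = f v}) = card (f ` A)"
proof -
  have "{(u, v). u \<in> A \<and> v \<in> A \<and> f u = f v} `` {x} = {u \<in> A. f u = f x}" if "x \<in> A" for x
    using that by auto
  then have "A // {(u, v). u \<in> A \<and> v \<in> A \<and> f u = f v} = (\<lambda>y. {u \<in> A. f u = y}) ` f ` A"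
    by (auto simp: quotient_def)
  moreover have "inj_on (\<lambda>y. {u \<in> A. f u = y}) (f ` A)"
    by (rule inj_onI) blast
  ultimately show ?thesis by (simp add: card_image)
qed

lemma add_complexity_tr_eq:
  "add_complexity tr n = card (range (\<lambda>i. score (parikh (stake (i + n) tr) - parikh (stake i tr))))"
proof -
  define f where "f u = score (parikh u)" for u
  have factor: "length u = n \<and> set u \<subseteq> {0, 1, 2}" if "u \<in> factors tr n" for u
  proof -
    obtain i where u: "u = stake n (sdrop i tr)" using \<open>u \<in> factors tr n\<close> by (auto simp: factors_def)
    have "set u \<subseteq> sset tr"
      unfolding u by (metis Un_subset_iff order_refl sset_shift stake_sdrop)
    then show ?thesis using u sset_tr by auto
  qed
  have "{(u, v). u \<in> factors tr n \<and> v \<in> factors tr n \<and> add_equiv u v} =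
      {(u, v). u \<in> factors tr n \<and> v \<in> factors tr n \<and> f u = f v}"
    using factor by (auto simp: add_equiv_def f_def score_parikh simp flip: of_nat_mult of_nat_add)
  then have "add_complexity tr n = card (f ` factors tr n)"
    by (simp add: add_complexity_def card_quotient_kernel)
  also have "f ` factors tr n = range (\<lambda>i. f (stake n (sdrop i tr)))"
    unfolding factors_def by blast
  also have "(\<lambda>i. f (stake n (sdrop i tr)))
      = (\<lambda>i. score (parikh (stake (i + n) tr) - parikh (stake i tr)))"
  proof
    fix i
    have "stake (i + n) tr = stake i tr @ stake n (sdrop i tr)" by (simp only: stake_add)
    then show "f (stake n (sdrop i tr)) = score (parikh (stake (i + n) tr) - parikh (stake i tr))"
      by (simp only: f_def parikh_simps add_diff_cancel_left')
  qed
  finally show ?thesis .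
qed

text \<open>Coordinate sum 0 singles out the pairs with \<open>j = i + n\<close>. Reading
  \<open>n\<close> in parallel subtracts the same prefix score from all of them, a shift that does
  not affect the number of values.\<close>

lemma score_run_greedy_digits:
  assumes "n < trib k"
  shows "{s. \<exists>q \<in> run (greedy_digits k n) {(0, 0, 0)}. balanced_with s q} =
    (\<lambda>i. score (parikh (stake (i + n) tr) - parikh (stake i tr)) - score (parikh (stake n tr))) `
      {i. i + n < trib k}"
    (is "?L = ?R")
proof -
  define P where "P i = parikh (take i (block k 0))" for i
  have P: "P i = parikh (stake i tr)" if "i < trib k" for i
    using that by (simp add: P_def stake_tr)
  have weight_P: "weight (P j - P i - P n) = int j - int i - int n" if "i < trib k" "j < trib k" for i j
    using that assms by (simp add: P weight_diff weight_parikh)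
  have run: "run (greedy_digits k n) {(0, 0, 0)} =
    {(block k 0 ! i, block k 0 ! j, P j - P i - P n) |i j. i < trib k \<and> j < trib k}"
  proof -
    have points: "points k 0 = {(block k 0 ! i, P i) |i. i < trib k}"
      by (auto simp: points_def P_def length_block_0)
    have "run (greedy_digits k n) {(0, 0, 0)} =
        {(l, l', v' - v - P n) |l v l' v'. (l, v) \<in> points k 0 \<and> (l', v') \<in> points k 0}"
      using run_greedy_digits[of n k 0 0 0 0] assms
      by (simp only: length_block_0 power_M_zero add_0_left P_def)
    then show ?thesis unfolding points by blast
  qed
  define B where "B i = score (parikh (stake (i + n) tr) - parikh (stake i tr)) -
    score (parikh (stake n tr))" for i
  have balanced: "i < trib k \<and> j < trib k \<and> balanced_with s (a, b, P j - P i - P n) \<longleftrightarrow>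
      j = i + n \<and> i + n < trib k \<and> s = B i" for i j s a b
  proof (cases "i < trib k \<and> j < trib k")
    case True
    then have "weight (P j - P i - P n) = 0 \<longleftrightarrow> j = i + n" using weight_P by auto
    moreover have "score (P (i + n) - P i - P n) = B i" if "i + n < trib k"
      using that assms True by (simp add: P score_diff B_def)
    ultimately show ?thesis using True by auto
  qed auto
  have "(\<exists>q \<in> run (greedy_digits k n) {(0, 0, 0)}. balanced_with s q) \<longleftrightarrow>
      (\<exists>i j. i < trib k \<and> j < trib k \<and>
        balanced_with s (block k 0 ! i, block k 0 ! j, P j - P i - P n))" for s
    unfolding run by blast
  then show ?thesis unfolding balanced by (auto simp: B_def)
qed

text \<open>Reading another 0 fixes \<open>initial_code\<close>, so six zeros stand for any larger
  padding.\<close>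

lemma elems_initial_code:
  assumes "6 \<le> j"
  shows "elems live_tree initial_code = live_run (replicate j 0) {(0, 0, 0)}"
proof -
  define E where "E = encode [(0, 0, 0, 0, 0)] live_tree"
  have iter: "live_run (replicate j 0) (elems live_tree X) =
      elems live_tree ((image_code (live_step 0) ^^ j) X)" for j X
    by (induction j arbitrary: X) (simp_all add: elems_live_step[symmetric] funpow_swap1
        del: succs.simps succ_code.simps)
  have "(image_code (live_step 0) ^^ j) E = initial_code"
    using assms
  proof (induction j rule: dec_induct)
    case base
    show ?case by (simp only: initial_code_def E_def)
  next
    case (step j)
    then show ?case using initial_code_fixed by (simp del: succ_code.simps)
  qed
  moreover have "elems live_tree E = {(0, 0, 0)}"
    using start_live by (auto simp: E_def elems_encode set_live_tree zero_prod_def)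
  ultimately show ?thesis using iter[of j E] by simp
qed

text \<open>The same set \<open>X\<close> describes every padding by at least six zeros, and with
  growing padding the windows \<open>i + n < trib (j + length w)\<close> exhaust all positions
  \<open>i\<close>.\<close>

lemma dfa_out_eq: "dfa_out (foldl dfa_step 0 (trib_rep n)) = add_complexity tr n"
proof -
  define w where "w = trib_rep n"
  obtain Z where Z: "(0, 0, initial_code) \<in> Z" "\<forall>C\<in>Z. row_correct C \<and> set (row_succs C) \<subseteq> Z"
    using ex_bisimulation by blast
  then obtain t X where X: "(foldl dfa_step 0 w, t, X) \<in> Z"
    "elems live_tree X = live_run w (elems live_tree initial_code)"
    using bisimulation_valid[of Z 0 0 initial_code w] valid_trib_rep by (auto simp: w_def)
  define B where "B i = score (parikh (stake (i + n) tr) - parikh (stake i tr))" for i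
  define c where "c = score (parikh (stake n tr))"
  have n: "n < trib (j + length w)" for j
    using trib_rep_length[of n] strict_mono_less_eq[OF trib_strict_mono, of "length w" "j + length w"]
    by (simp add: w_def)
  have scores: "{s. \<exists>q \<in> elems live_tree X. balanced_with s q} =
      (\<lambda>i. B i - c) ` {i. i + n < trib (j + length w)}" if "6 \<le> j" for j
  proof -
    have digits: "greedy_digits (j + length w) n = replicate j 0 @ w"
      using greedy_digits_leading_zeros[of n "length w" j] trib_rep_length[of n] greedy_digits_trib_rep[of n]
      by (simp add: w_def)
    have w01: "set (replicate j 0 @ w) \<subseteq> {0, 1}" using set_trib_rep by (auto simp: w_def)
    have start: "\<forall>q \<in> {(0, 0, 0)}. reachable q" "{(0, 0, 0)} \<inter> set live = {(0, 0, 0)}"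
      using reachable_start start_live by (auto simp: zero_prod_def)
    have "elems live_tree X = live_run (replicate j 0 @ w) ({(0, 0, 0)} \<inter> set live)"
      using X(2) elems_initial_code[OF that] start(2) by (simp add: live_run_append)
    also have "\<dots> = run (replicate j 0 @ w) {(0, 0, 0)} \<inter> set live"
      by (rule live_run_eq[OF start(1) w01])
    finally have X_eq: "elems live_tree X = run (replicate j 0 @ w) {(0, 0, 0)} \<inter> set live" .
    \<comment> \<open>Scores are read off states of coordinate sum 0 only, and these are
      live.\<close>
    have "q \<in> set live" if "q \<in> run (replicate j 0 @ w) {(0, 0, 0)}" "balanced_with s q" for q s
      using reachable_run[OF start(1) w01 that(1)] that(2) reachable_balanced by (cases q) auto
    then have "{s. \<exists>q \<in> elems live_tree X. balanced_with s q} =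
        {s. \<exists>q \<in> run (replicate j 0 @ w) {(0, 0, 0)}. balanced_with s q}"
      unfolding X_eq by blast
    then show ?thesis
      using score_run_greedy_digits[OF n[of j]] by (simp add: digits B_def c_def)
  qed
  have "{s. \<exists>q \<in> elems live_tree X. balanced_with s q} = range (\<lambda>i. B i - c)"
  proof
    show "{s. \<exists>q \<in> elems live_tree X. balanced_with s q} \<subseteq> range (\<lambda>i. B i - c)"
      using scores[of 6] by auto
    show "range (\<lambda>i. B i - c) \<subseteq> {s. \<exists>q \<in> elems live_tree X. balanced_with s q}"
    proof
      fix s assume "s \<in> range (\<lambda>i. B i - c)"
      then obtain i where i: "s = B i - c" by blast
      \<comment> \<open>As \<open>m < trib m\<close>, this padding is long enough for the position
        \<open>i + n\<close>; the summand 6 meets the condition of \<open>scores\<close>.\<close>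
      define j where "j = i + n + 6"
      have "i + n < trib (j + length w)"
        using trib_gt[of "j + length w"] by (simp add: j_def)
      then show "s \<in> {s. \<exists>q \<in> elems live_tree X. balanced_with s q}"
        using i by (subst scores[of j]) (auto simp: j_def)
    qed
  qed
  also have "range (\<lambda>i. B i - c) = (\<lambda>s. s - c) ` range B" by auto
  finally have "card {s. \<exists>q \<in> elems live_tree X. balanced_with s q} = card (range B)"
    by (simp add: card_image)
  then show ?thesis
    using Z(2) X(1) unfolding w_def[symmetric] dfa_out_def add_complexity_tr_eq B_def
    by (fastforce simp: count_has_score_trees)
qed

section \<open>Values of the complexity and their infinite recurrence\<close>

fun dfa_row_ok :: "dfa_index \<Rightarrow> nat \<Rightarrow> bool" where
  "dfa_row_ok D q \<longleftrightarrow> (case fetch q D of (v, q0, q1) \<Rightarrow>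
     q0 < 76 \<and> q1 < 76 \<and> (q = 0 \<or> 0 < q0 \<and> 0 < q1 \<and> 3 \<le> v \<and> v \<le> 5))"

lemma dfa_rows_ok: "list_all (dfa_row_ok dfa_index) [0..<76]"
  by code_simp

lemma dfa_step_less: "q < 76 \<Longrightarrow> dfa_step q c < 76"
  and dfa_step_pos: "q < 76 \<Longrightarrow> 0 < q \<Longrightarrow> 0 < dfa_step q c"
  and dfa_out_bounds: "q < 76 \<Longrightarrow> 0 < q \<Longrightarrow> dfa_out q \<in> {3, 4, 5}"
proof -
  assume "q < 76"
  then have "dfa_row_ok dfa_index q" using dfa_rows_ok by (simp add: list_all_iff)
  moreover have "v \<in> {3, 4, 5}" if "3 \<le> v" "v \<le> 5" for v :: nat using that by auto
  ultimately show "dfa_step q c < 76" "0 < q \<Longrightarrow> 0 < dfa_step q c"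
    "0 < q \<Longrightarrow> dfa_out q \<in> {3, 4, 5}"
    by (auto simp: dfa_step_def dfa_out_def split: prod.splits)
qed

lemma dfa_step_0_1: "dfa_step 0 1 = 1"
  by code_simp

lemma foldl_dfa_step:
  "0 < q \<Longrightarrow> q < 76 \<Longrightarrow> 0 < foldl dfa_step q w \<and> foldl dfa_step q w < 76"
  by (induction w arbitrary: q) (simp_all add: dfa_step_pos dfa_step_less)

text \<open>The leading 1 leads from state 0 to state 1, and the nonzero states are closed under
  both digits and output only 3, 4 or 5.\<close>

lemma add_complexity_tr_values:
  assumes "1 \<le> n"
  shows "add_complexity tr n \<in> {3, 4, 5}"
proof -
  obtain w where w: "trib_rep n = 1 # w" using trib_rep_leading_one[OF assms] by blast
  have "add_complexity tr n = dfa_out (foldl dfa_step 1 w)"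
    unfolding dfa_out_eq[symmetric] w foldl.simps dfa_step_0_1 ..
  then show ?thesis using foldl_dfa_step[of 1 w] dfa_out_bounds by simp
qed

text \<open>A 0 resets the count of trailing ones, so valid words can be joined after it.\<close>

lemma valid_append_zero: "valid t (v @ [0]) \<Longrightarrow> valid 0 w \<Longrightarrow> valid t (v @ 0 # w)"
  by (induction v arbitrary: t) (auto simp: children_def split: if_splits)

text \<open>Repeating a cycle at \<open>q\<close> yields representations of different lengths, hence
  different numbers, all with the output of \<open>q\<close>. The final zeros allow the pieces to be
  concatenated.\<close>

lemma infinite_pumped:
  assumes "valid 0 (1 # v @ [0])" "valid 0 (u @ [0])"
    and "foldl dfa_step 0 (1 # v @ [0]) = q" "foldl dfa_step q (u @ [0]) = q"
  shows "infinite {n. add_complexity tr n = dfa_out q}"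
proof -
  define W where "W k = 1 # v @ [0] @ concat (replicate k (u @ [0]))" for k
  have "valid 0 (concat (replicate k (u @ [0])))" for k
    by (induction k) (simp_all add: valid_append_zero[OF assms(2)])
  then have valid: "valid 0 (W k)" for k
    using valid_append_zero[of 0 "1 # v"] assms(1) by (simp add: W_def del: valid.simps)
  have "foldl dfa_step q (concat (replicate k (u @ [0]))) = q" for k
    using assms(4) by (induction k) simp_all
  then have state: "foldl dfa_step 0 (W k) = q" for k
    using assms(3) by (simp add: W_def)
  have "\<exists>n. trib_rep n = W k" for k
  proof -
    define w where "w = v @ [0] @ concat (replicate k (u @ [0]))"
    have W: "W k = 1 # w" by (simp add: W_def w_def)
    obtain n where "n < trib (length (W k))" "greedy_digits (length (W k)) n = W k"
      using greedy_digits_valid[OF valid[of k]] by (auto simp: length_block_0)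
    then have "trib_rep n = 1 # w"
      unfolding W list.size(4) add_0_right add_Suc_right
      by (intro greedy_digits_eq_trib_rep[of "length w"])
    then show ?thesis unfolding W ..
  qed
  then obtain N where N: "trib_rep (N k) = W k" for k by metis
  have "inj N"
  proof (rule injI)
    fix k l assume "N k = N l"
    then have "length (W k) = length (W l)" using N by metis
    then show "k = l" by (simp add: W_def length_concat sum_list_replicate flip: mult_Suc_right)
  qed
  moreover have "range N \<subseteq> {n. add_complexity tr n = dfa_out q}"
    using dfa_out_eq[of "N _"] N state by auto
  ultimately show ?thesis using finite_subset finite_imageD infinite_UNIV_nat by blast
qed

text \<open>One cycle per value. All words end in 0 and the access words begin with 1, as pumping
  requires.\<close>

lemma dfa_cycles:
  "foldl dfa_step 0 [1, 0, 0] = 4" "foldl dfa_step 4 [1, 0, 0] = 4" "dfa_out 4 = 3"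
  "foldl dfa_step 0 [1, 0, 1, 0] = 9" "foldl dfa_step 9 [1, 0] = 9" "dfa_out 9 = 4"
  "foldl dfa_step 0 [1, 0, 0, 1, 1, 0, 0] = 25" "foldl dfa_step 25 [1, 1, 0, 0] = 25" "dfa_out 25 = 5"
  by code_simp+

definition trib_add_dfao :: "(nat, nat, nat) dfao" where
  "trib_add_dfao = \<lparr>states = {..<76}, initial = 0, trans = dfa_step, outp = dfa_out\<rparr>"

lemma trib_dfao_computes_add_complexity:
  "trib_dfao_computes trib_add_dfao (add_complexity tr)"
  by (auto simp: trib_dfao_computes_def is_dfao_def trib_add_dfao_def dfao_output_def dfa_out_eq
      dfa_step_less)

theorem theorem4p2:
  shows "(\<forall>n\<ge>1. add_complexity tr n \<in> {3, 4, 5}) \<and>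
    (\<forall>c\<in>{3, 4, 5}. infinite {n. add_complexity tr n = c}) \<and>
    (\<exists>M :: (nat, nat, nat) dfao.
       card (states M) = 76 \<and> trib_dfao_computes M (add_complexity tr))"
proof (intro conjI)
  show "\<forall>n\<ge>1. add_complexity tr n \<in> {3, 4, 5}"
    using add_complexity_tr_values by blast
  \<comment> \<open>The access words and cycles of \<open>dfa_cycles\<close> are matched as
    \<open>1 # v @ [0]\<close> and \<open>u @ [0]\<close>.\<close>
  have "infinite {n. add_complexity tr n = 3}"
    using infinite_pumped[of "[0]" "[1, 0]" 4] dfa_cycles by (simp add: children_def)
  moreover have "infinite {n. add_complexity tr n = 4}"
    using infinite_pumped[of "[0, 1]" "[1]" 9] dfa_cycles by (simp add: children_def)
  moreover have "infinite {n. add_complexity tr n = 5}"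
    using infinite_pumped[of "[0, 0, 1, 1, 0]" "[1, 1, 0]" 25] dfa_cycles by (simp add: children_def)
  ultimately show "\<forall>c\<in>{3, 4, 5}. infinite {n. add_complexity tr n = c}" by simp
  have "card (states trib_add_dfao) = 76" by (simp add: trib_add_dfao_def)
  then show "\<exists>M :: (nat, nat, nat) dfao.
       card (states M) = 76 \<and> trib_dfao_computes M (add_complexity tr)"
    using trib_dfao_computes_add_complexity by blast
qed

end
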